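(* Fix any $1\le s\le n/\mathrm{poly}\log n$. There exist a fixed constant $c>0$ and $\epsilon_0=\tilde{\Theta}(1)$ such that, given $\mathbf{A}\in\mathbb{R}^{n\times n}$ with $\|\mathbf{A}\|_\infty\le 1$, any non-adaptive sampling algorithm which distinguishes with probability at least $3/4$ between the cases (1) $\|\mathbf{A}-\mathbf{A}_s\|_F^2>\frac{c}{\log(s)}\cdot\frac{n^2}{s}$ and (2) $\|\mathbf{A}-\mathbf{A}_s\|_F^2<(1-\epsilon_0)\cdot\frac{c}{\log(s)}\cdot\frac{n^2}{s}$, must query at least $\tilde{\Omega}(s^2)$ entries of $\mathbf{A}$.
   Context: $\|\mathbf{A}\|_\infty=\max_{i,j}|\mathbf{A}_{i,j}|$. $\mathbf{A}_s$ denotes the truncated SVD of $\mathbf{A}$ (a best rank-$s$ approximation), so $\|\mathbf{A}-\mathbf{A}_s\|_F^2=\sum_{j>s}\sigma_j^2(\mathbf{A})$. A non-adaptive sampling algorithm fixes its queried entries before seeing any answers. $\tilde{\Theta},\tilde{\Omega}$ hide polylogarithmic factors in $s$. *)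

theory Defs
  imports "HOL-Probability.Probability" "Jordan_Normal_Form.Matrix"
begin

definition max_norm :: "real mat \<Rightarrow> real" where
  "max_norm A = Max (abs ` elements_mat A)"

definition frobenius_norm :: "real mat \<Rightarrow> real" where
  "frobenius_norm A = sqrt (\<Sum>i<dim_row A. \<Sum>j<dim_col A. (A $$ (i, j))\<^sup>2)"

(* Jordan_Normal_Form's orthogonal_mat only asks for pairwise orthogonal nonzero columns;
   an SVD needs orthonormal ones. *)
definition orthonormal_mat :: "nat \<Rightarrow> real mat \<Rightarrow> bool" where
  "orthonormal_mat n U \<longleftrightarrow> U \<in> carrier_mat n n \<and> transpose_mat U * U = 1\<^sub>m n"

definition is_svd :: "real mat \<Rightarrow> real mat \<Rightarrow> real mat \<Rightarrow> real mat \<Rightarrow> bool" where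
  "is_svd A U S V \<longleftrightarrow>
     orthonormal_mat (dim_row A) U \<and> orthonormal_mat (dim_col A) V \<and>
     S \<in> carrier_mat (dim_row A) (dim_col A) \<and> diagonal_mat S \<and>
     (\<forall>i < min (dim_row A) (dim_col A). S $$ (i, i) \<ge> 0) \<and>
     (\<forall>i j. i \<le> j \<and> j < min (dim_row A) (dim_col A) \<longrightarrow> S $$ (j, j) \<le> S $$ (i, i)) \<and>
     A = U * S * transpose_mat V"

definition keep_leading_diag :: "nat \<Rightarrow> real mat \<Rightarrow> real mat" where
  "keep_leading_diag s S =
     Matrix.mat (dim_row S) (dim_col S) (\<lambda>(i, j). if i = j \<and> i < s then S $$ (i, i) else 0)"

definition is_truncated_svd :: "nat \<Rightarrow> real mat \<Rightarrow> real mat \<Rightarrow> bool" where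
  "is_truncated_svd s A B \<longleftrightarrow>
     (\<exists>U S V. is_svd A U S V \<and> B = U * keep_leading_diag s S * transpose_mat V)"

(* A_s is not unique when singular values s and s+1 coincide, but the Frobenius norm of
   A - A_s does not depend on the choice. *)
definition truncated_svd :: "nat \<Rightarrow> real mat \<Rightarrow> real mat" where
  "truncated_svd s A = (SOME B. is_truncated_svd s A B)"

definition lowrank_error :: "nat \<Rightarrow> real mat \<Rightarrow> real" where
  "lowrank_error s A = (frobenius_norm (A - truncated_svd s A))\<^sup>2"

(* Base-2 logarithm, equal to log 2 m for all m \<ge> 2; the value 1 at m = 1 avoids a division
   by log 1 = 0. The choice of base only rescales the constants. *)
definition lg :: "nat \<Rightarrow> real" where
  "lg m = max 1 (log 2 (real m))"

definition Omega_tilde :: "(nat \<Rightarrow> real) \<Rightarrow> (nat \<Rightarrow> real) \<Rightarrow> bool" where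
  "Omega_tilde f g \<longleftrightarrow> (\<exists>C>0. \<exists>k::nat. \<forall>s\<ge>1. f s \<ge> C * g s / lg s ^ k)"

definition O_tilde :: "(nat \<Rightarrow> real) \<Rightarrow> (nat \<Rightarrow> real) \<Rightarrow> bool" where
  "O_tilde f g \<longleftrightarrow> (\<exists>C>0. \<exists>k::nat. \<forall>s\<ge>1. f s \<le> C * g s * lg s ^ k)"

definition Theta_tilde :: "(nat \<Rightarrow> real) \<Rightarrow> (nat \<Rightarrow> real) \<Rightarrow> bool" where
  "Theta_tilde f g \<longleftrightarrow> Omega_tilde f g \<and> O_tilde f g"

(* A randomized non-adaptive algorithm: the law of the set Q of queried positions, which is
   drawn before any answer is seen, and for each Q and each assignment of answers to Q the law
   of the Boolean output. Q takes finitely many values, so randomness shared between the two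
   phases is covered by letting the second law be the conditional one given Q. The algorithm
   may depend on n and s and its computation is unbounded. *)
type_synonym nonadaptive_alg =
  "(nat \<times> nat) set pmf \<times> ((nat \<times> nat) set \<Rightarrow> (nat \<times> nat \<Rightarrow> real) \<Rightarrow> bool pmf)"

definition run_alg :: "nonadaptive_alg \<Rightarrow> real mat \<Rightarrow> bool pmf" where
  "run_alg alg A =
     bind_pmf (fst alg) (\<lambda>Q. snd alg Q (restrict (\<lambda>ij. A $$ ij) Q))"

definition queries_at_most :: "nat \<Rightarrow> nat \<Rightarrow> nonadaptive_alg \<Rightarrow> bool" where
  "queries_at_most n q alg \<longleftrightarrow>
     (\<forall>Q \<in> set_pmf (fst alg). Q \<subseteq> {..<n} \<times> {..<n} \<and> card Q \<le> q)"

(* Output True stands for the first case; inputs in neither case are unconstrained. *)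
definition distinguishes ::
  "nat \<Rightarrow> (real mat \<Rightarrow> bool) \<Rightarrow> (real mat \<Rightarrow> bool) \<Rightarrow> nonadaptive_alg \<Rightarrow> bool" where
  "distinguishes n case1 case2 alg \<longleftrightarrow>
     (\<forall>A \<in> carrier_mat n n. max_norm A \<le> 1 \<longrightarrow>
        (case1 A \<longrightarrow> measure_pmf.prob (run_alg alg A) {True} \<ge> 3 / 4) \<and>
        (case2 A \<longrightarrow> measure_pmf.prob (run_alg alg A) {False} \<ge> 3 / 4))"

end

(* The hard instances consist of s diagonal blocks; each block is the L x L biadjacency matrix of
   a cycle of length 2L with L = Theta(log s), every entry blown up to an N x N block with
   N about n/(sL). Rows and columns are permuted and given signs at random. Either all cycles are
   balanced (product of the signs +1) or all are frustrated (product -1).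

   A balanced cycle has one top singular value 2, attained by the constant vector, whereas a
   frustrated cycle stretches no vector by more than sqrt (4 - 4/L^2). Both matrices have the same
   Frobenius norm, so the rank-s errors are in ratio at most (2L-4) / (2L-4+4/L^2), which is a gap
   of order 1/L^3, at the level n^2/(sL). Rescaling all entries puts the threshold in the gap.

   If for some k no query hits the k-th matching edge of a block, then changing the signs along the
   path from that edge to the frustrated one turns the frustrated cycle into a balanced one without
   altering any answer. Otherwise, for some block, L queries with distinct rows and columns all
   fall on prescribed labels; with q < s^2 queries this has probability at most
   s q^L (2N/n)^(2L) <= 1/16. *)
theory Submission
  imports Defs "HOL-Combinatorics.Permutations"
begin

section \<open>Orthonormal systems and the singular value decomposition\<close>

text \<open>Length trades secrecy for gap. With q near s^2, each further matching edge multiplies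
  the probability of seeing a cycle by about q (2N/n)^2, roughly (2/L)^2, so a length logarithmic in
  s beats the union bound over s blocks. Against this, frustration lowers the top squared singular
  value only by order 1/L^2 while the error is of order L. All polylogarithmic loss thus goes into
  \<epsilon> and the range of s; the query bound itself is exactly s^2. The two sources of
  randomness have different tasks. Permutations hide where the matching edges lie. Uniform signs
  turn a change of signs along a path into a bijection between instances, so that answers agree in
  law and not just for one pair of matrices. Since queries are fixed in advance, the bad event
  involves only the query set and the permutations. On the spectral side
  \<open>truncated_svd\<close> is a choice, meaningful only once an SVD is known to exist. The
  singular values of the hard matrices are never computed: a bound on every stretch controls the
  error from below, trial vectors control it from above.\<close>

definition dotp :: "nat \<Rightarrow> (nat \<Rightarrow> real) \<Rightarrow> (nat \<Rightarrow> real) \<Rightarrow> real" where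
  "dotp n x y = (\<Sum>k<n. x k * y k)"

definition mat_app :: "nat \<Rightarrow> (nat \<Rightarrow> nat \<Rightarrow> real) \<Rightarrow> (nat \<Rightarrow> real) \<Rightarrow> nat \<Rightarrow> real" where
  "mat_app n a x = (\<lambda>i. \<Sum>k<n. a i k * x k)"

definition orthonormal :: "nat \<Rightarrow> nat \<Rightarrow> (nat \<Rightarrow> nat \<Rightarrow> real) \<Rightarrow> bool" where
  "orthonormal n k v \<longleftrightarrow> (\<forall>i<k. \<forall>j<k. dotp n (v i) (v j) = (if i = j then 1 else 0))"

lemma dotp_commute: "dotp n x y = dotp n y x"
  by (simp add: dotp_def mult.commute)

lemma dotp_add_right: "dotp n x (\<lambda>c. y c + z c) = dotp n x y + dotp n x z"
  by (simp add: dotp_def algebra_simps sum.distrib)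

lemma dotp_diff_right: "dotp n x (\<lambda>c. y c - z c) = dotp n x y - dotp n x z"
  by (simp add: dotp_def algebra_simps sum_subtractf)

lemma dotp_scale_right: "dotp n x (\<lambda>c. r * y c) = r * dotp n x y"
  by (simp add: dotp_def sum_distrib_left mult_ac)

lemma dotp_sum_right: "dotp n x (\<lambda>c. \<Sum>i\<in>I. f i c) = (\<Sum>i\<in>I. dotp n x (f i))"
  unfolding dotp_def sum_distrib_left by (rule sum.swap)

lemma dotp_add_left: "dotp n (\<lambda>c. y c + z c) x = dotp n y x + dotp n z x"
  by (simp add: dotp_def algebra_simps sum.distrib)

lemma dotp_scale_left: "dotp n (\<lambda>c. r * y c) x = r * dotp n y x"
  by (simp add: dotp_def sum_distrib_left mult_ac)

lemma dotp_nonneg: "dotp n x x \<ge> 0"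
  by (simp add: dotp_def sum_nonneg)

lemma dotp_eq_0: "dotp n x x = 0 \<Longrightarrow> k < n \<Longrightarrow> x k = 0"
  by (simp add: dotp_def sum_nonneg_eq_0_iff)

lemma dotp_cong:
  "(\<And>k. k < n \<Longrightarrow> x k = x' k) \<Longrightarrow> (\<And>k. k < n \<Longrightarrow> y k = y' k) \<Longrightarrow> dotp n x y = dotp n x' y'"
  by (simp add: dotp_def)

lemma mat_app_add: "mat_app n a (\<lambda>c. x c + y c) = (\<lambda>i. mat_app n a x i + mat_app n a y i)"
  by (simp add: mat_app_def algebra_simps sum.distrib)

lemma mat_app_scale: "mat_app n a (\<lambda>c. r * x c) = (\<lambda>i. r * mat_app n a x i)"
  by (simp add: mat_app_def sum_distrib_left mult_ac)

lemma residual_orthogonal: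
  assumes "orthonormal n k v" "j < k"
  shows "dotp n (v j) (\<lambda>c. x c - (\<Sum>i<k. dotp n (v i) x * v i c)) = 0"
proof -
  have "(\<Sum>i<k. dotp n (v i) x * dotp n (v j) (v i)) = (\<Sum>i<k. if i = j then dotp n (v i) x else 0)"
    using assms by (intro sum.cong) (auto simp: orthonormal_def)
  then show ?thesis
    using assms(2) by (simp add: dotp_diff_right dotp_sum_right dotp_scale_right)
qed

lemma residual_norm:
  fixes x :: "nat \<Rightarrow> real"
  assumes "orthonormal n k v"
  defines "r \<equiv> (\<lambda>c. x c - (\<Sum>i<k. dotp n (v i) x * v i c))"
  shows "dotp n r r = dotp n x x - (\<Sum>i<k. (dotp n (v i) x)\<^sup>2)"
proof -
  have orth: "dotp n r (v i) = 0" if "i < k" for i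
    using residual_orthogonal[OF assms(1) that] by (simp add: r_def dotp_commute)
  have "dotp n r r = dotp n r x - (\<Sum>i<k. dotp n (v i) x * dotp n r (v i))"
    by (subst (2) r_def) (simp add: dotp_diff_right dotp_sum_right dotp_scale_right)
  also have "\<dots> = dotp n x r"
    by (simp add: orth dotp_commute)
  also have "\<dots> = dotp n x x - (\<Sum>i<k. (dotp n (v i) x)\<^sup>2)"
    unfolding r_def dotp_diff_right dotp_sum_right dotp_scale_right
    by (simp add: power2_eq_square dotp_commute)
  finally show ?thesis .
qed

lemma bessel:
  assumes "orthonormal n k v"
  shows "(\<Sum>i<k. (dotp n (v i) x)\<^sup>2) \<le> dotp n x x"
  using residual_norm[OF assms, of x] dotp_nonneg[of n "\<lambda>c. x c - (\<Sum>i<k. dotp n (v i) x * v i c)"]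
  by linarith

definition unit_vec_fun :: "nat \<Rightarrow> nat \<Rightarrow> real" where
  "unit_vec_fun c = (\<lambda>k. if k = c then 1 else 0)"

lemma dotp_unit: "c < n \<Longrightarrow> dotp n x (unit_vec_fun c) = x c"
  by (simp add: dotp_def unit_vec_fun_def if_distrib[of "(*) _"] cong: if_cong)

lemma sum_sq_orthonormal:
  assumes "orthonormal n k v"
  shows "(\<Sum>c<n. \<Sum>i<k. (v i c)\<^sup>2) = real k"
proof -
  have "(\<Sum>c<n. \<Sum>i<k. (v i c)\<^sup>2) = (\<Sum>i<k. dotp n (v i) (v i))"
    by (subst sum.swap) (simp add: dotp_def power2_eq_square)
  then show ?thesis using assms by (simp add: orthonormal_def)
qed

text \<open>A dimension count: the squared entries of the family sum to \<open>k < n\<close> over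
  \<open>n\<close> coordinates, so some coordinate vector has a projection of squared length below
  1, and its normalised residual works. Vanishing from \<open>n\<close> on later places the
  candidates in a compact set.\<close>

lemma ex_orthogonal_unit:
  assumes v: "orthonormal n k v" and "k < n"
  shows "\<exists>x. dotp n x x = 1 \<and> (\<forall>i<k. dotp n (v i) x = 0) \<and> (\<forall>i\<ge>n. x i = 0)"
proof -
  have "\<exists>c<n. (\<Sum>i<k. (v i c)\<^sup>2) < 1"
  proof (rule ccontr)
    assume "\<not> ?thesis"
    then have "\<forall>c<n. 1 \<le> (\<Sum>i<k. (v i c)\<^sup>2)"
      by (meson not_less)
    then have "(\<Sum>c<n. 1) \<le> (\<Sum>c<n. \<Sum>i<k. (v i c)\<^sup>2)"
      by (intro sum_mono) (simp add: not_less)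
    then show False using sum_sq_orthonormal[OF v] \<open>k < n\<close> by simp
  qed
  then obtain c where c: "c < n" "(\<Sum>i<k. (v i c)\<^sup>2) < 1" by blast
  define r where "r = (\<lambda>d. unit_vec_fun c d - (\<Sum>i<k. dotp n (v i) (unit_vec_fun c) * v i d))"
  have "dotp n r r > 0"
    unfolding r_def residual_norm[OF v] using c by (simp add: dotp_unit) (simp add: unit_vec_fun_def)
  have orth: "dotp n (v i) r = 0" if "i < k" for i
    unfolding r_def by (rule residual_orthogonal[OF v that])
  define y where "y = (\<lambda>d. if d < n then (1 / sqrt (dotp n r r)) * r d else 0)"
  have y: "dotp n z y = dotp n z r / sqrt (dotp n r r)" for z
  proof -
    have "dotp n z y = dotp n z (\<lambda>d. (1 / sqrt (dotp n r r)) * r d)"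
      by (rule dotp_cong) (auto simp: y_def)
    then show ?thesis by (simp only: dotp_scale_right) simp
  qed
  have "dotp n y y = dotp n r y / sqrt (dotp n r r)"
    by (subst y) (simp add: dotp_commute)
  also have "\<dots> = 1"
    using \<open>dotp n r r > 0\<close> by (simp add: y real_div_sqrt)
  finally have "dotp n y y = 1" .
  moreover have "dotp n (v i) y = 0" if "i < k" for i
    using orth[OF that] by (simp add: y)
  moreover have "y i = 0" if "i \<ge> n" for i using that by (simp add: y_def)
  ultimately show ?thesis by blast
qed

text \<open>Supplies left singular vectors where the singular value is 0 and the image provides
  none.\<close>

lemma orthonormal_extend:
  assumes "orthonormal n k v" "k \<le> n"
  shows "\<exists>v'. orthonormal n n v' \<and> (\<forall>i<k. v' i = v i)"
proof -
  have "\<exists>v'. orthonormal n (k + d) v' \<and> (\<forall>i<k. v' i = v i)" if "k + d \<le> n" for d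
    using that
  proof (induction d)
    case 0
    then show ?case using assms by auto
  next
    case (Suc d)
    then obtain v' where v': "orthonormal n (k + d) v'" "\<forall>i<k. v' i = v i" by auto
    have "k + d < n" using Suc.prems by simp
    then obtain x where x: "dotp n x x = 1" "\<forall>i<k + d. dotp n (v' i) x = 0"
      using ex_orthogonal_unit[OF v'(1)] by blast
    moreover have "\<forall>i<k + d. dotp n x (v' i) = 0" using x(2) by (metis dotp_commute)
    ultimately have orth: "orthonormal n (k + Suc d) (v'(k + d := x))"
      using v'(1) by (auto simp: orthonormal_def less_Suc_eq)
    show ?case
      by (intro exI conjI, rule orth) (use v'(2) in auto)
  qed
  from this[of "n - k"] show ?thesis using assms by simp
qed

text \<open>Completeness by counting: Bessel's inequality bounds the projection of each unit vector
  by 1, and the \<open>n\<close> bounded values add up to \<open>n\<close>, so all equal 1 and every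
  unit vector has residual 0.\<close>

lemma orthonormal_expand:
  assumes v: "orthonormal n n v" and "c < n"
  shows "x c = (\<Sum>i<n. dotp n (v i) x * v i c)"
    and "dotp n x x = (\<Sum>i<n. (dotp n (v i) x)\<^sup>2)"
proof -
  have le: "(\<Sum>i<n. (v i c)\<^sup>2) \<le> 1" if "c < n" for c
    using bessel[OF v, of "unit_vec_fun c"] that by (simp add: dotp_unit) (simp add: unit_vec_fun_def)
  have eq1: "(\<Sum>i<n. (v i c)\<^sup>2) = 1" if "c < n" for c
  proof -
    have "(\<Sum>c<n. 1 - (\<Sum>i<n. (v i c)\<^sup>2)) = 0"
      using sum_sq_orthonormal[OF v] by (simp add: sum_subtractf)
    then show ?thesis
      using le that by (subst (asm) sum_nonneg_eq_0_iff) auto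
  qed
  have unit: "(\<Sum>i<n. v i c * v i d) = (if d = c then 1 else 0)" if "c < n" "d < n" for c d
  proof -
    let ?r = "\<lambda>d. unit_vec_fun c d - (\<Sum>i<n. dotp n (v i) (unit_vec_fun c) * v i d)"
    have "dotp n ?r ?r = 0"
      unfolding residual_norm[OF v] using eq1[OF that(1)] that
      by (simp add: dotp_unit) (simp add: unit_vec_fun_def)
    from dotp_eq_0[OF this that(2)] have "unit_vec_fun c d = (\<Sum>i<n. v i c * v i d)"
      using that by (simp add: dotp_unit)
    then show ?thesis unfolding unit_vec_fun_def by (rule sym)
  qed
  have 1: "x c = (\<Sum>i<n. dotp n (v i) x * v i c)" if "c < n" for c
  proof -
    have "(\<Sum>i<n. dotp n (v i) x * v i c) = (\<Sum>d<n. x d * (\<Sum>i<n. v i c * v i d))"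
      unfolding dotp_def sum_distrib_left sum_distrib_right by (subst sum.swap) (simp add: mult_ac)
    also have "\<dots> = (\<Sum>d<n. if d = c then x d else 0)"
      using that by (intro sum.cong) (auto simp: unit)
    finally show ?thesis using that by simp
  qed
  have 2: "x c - (\<Sum>i<n. dotp n (v i) x * v i c) = 0" if "c < n" for c
    using 1[OF that] by linarith
  have "dotp n (\<lambda>c. x c - (\<Sum>i<n. dotp n (v i) x * v i c)) (\<lambda>c. x c - (\<Sum>i<n. dotp n (v i) x * v i c))
      = dotp n (\<lambda>_. 0) (\<lambda>_. 0)"
    by (rule dotp_cong) (fact 2)+
  also have "\<dots> = 0" by (simp add: dotp_def)
  finally show "dotp n x x = (\<Sum>i<n. (dotp n (v i) x)\<^sup>2)"
    using residual_norm[OF v, of x] by simp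
  show "x c = (\<Sum>i<n. dotp n (v i) x * v i c)" using 1 assms(2) .
qed

section \<open>Existence of a singular value decomposition by compactness\<close>

lemma continuous_on_dotp:
  fixes f g :: "(nat \<Rightarrow> real) \<Rightarrow> nat \<Rightarrow> real"
  assumes "\<And>i. continuous_on A (\<lambda>x. f x i)" "\<And>i. continuous_on A (\<lambda>x. g x i)"
  shows "continuous_on A (\<lambda>x. dotp n (f x) (g x))"
  unfolding dotp_def by (intro continuous_on_sum continuous_on_mult assms)

text \<open>Fixing the coordinates from \<open>n\<close> on to 0 puts the unit sphere inside a
  product of intervals, compact by Tychonoff; all conditions are closed.\<close>

lemma compact_orthogonal_units:
  "compact {x :: nat \<Rightarrow> real. dotp n x x = 1 \<and> (\<forall>i<k. dotp n (v i) x = 0) \<and> (\<forall>i\<ge>n. x i = 0)}"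
    (is "compact ?S")
proof -
  have "compactin (product_topology (\<lambda>_. euclidean) UNIV) (PiE UNIV (\<lambda>_::nat. {-1..1::real}))"
    by (simp add: compactin_PiE)
  then have box: "compact (PiE UNIV (\<lambda>_::nat. {-1..1::real}))"
    by (simp add: euclidean_product_topology)
  have "closed {x :: nat \<Rightarrow> real. dotp n x x = 1}"
    by (intro closed_Collect_eq continuous_on_dotp continuous_on_const continuous_on_product_coordinates)
  moreover have "closed {x :: nat \<Rightarrow> real. dotp n (v i) x = 0}" for i
    by (intro closed_Collect_eq continuous_on_dotp continuous_on_const continuous_on_product_coordinates)
  moreover have "closed {x :: nat \<Rightarrow> real. x i = 0}" for i
    by (intro closed_Collect_eq continuous_on_const continuous_on_product_coordinates)
  ultimately have "closed ({x. dotp n x x = 1} \<inter> (\<Inter>i\<in>{..<k}. {x. dotp n (v i) x = 0})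
      \<inter> (\<Inter>i\<in>{n..}. {x. x i = 0}))"
    by (intro closed_Int closed_INT ballI) auto
  also have "\<dots> = ?S" by auto
  finally have "closed ?S" .
  moreover have "?S \<subseteq> PiE UNIV (\<lambda>_. {-1..1})"
  proof
    fix x assume x: "x \<in> ?S"
    have "\<bar>x i\<bar> \<le> 1" for i
    proof (cases "i < n")
      case True
      then have "(x i)\<^sup>2 \<le> dotp n x x"
        unfolding dotp_def power2_eq_square by (intro member_le_sum) auto
      then show ?thesis using x by (simp add: abs_square_le_1)
    next
      case False
      then show ?thesis using x by auto
    qed
    then show "x \<in> PiE UNIV (\<lambda>_. {-1..1})" by (auto simp: abs_le_iff minus_le_iff)
  qed
  ultimately show ?thesis using compact_Int_closed[OF box, of ?S] by (simp only: Int_absorb1)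
qed

text \<open>A maximum over the compact sphere is attained, and scaling makes the inequality
  homogeneous. That form admits unnormalised test vectors, such as a perturbed maximiser.\<close>

lemma ex_max_stretch:
  assumes "orthonormal n k v" "k < n"
  shows "\<exists>x. dotp n x x = 1 \<and> (\<forall>i<k. dotp n (v i) x = 0) \<and>
    (\<forall>y. (\<forall>i<k. dotp n (v i) y = 0) \<longrightarrow>
       dotp n (mat_app n a y) (mat_app n a y) \<le> dotp n (mat_app n a x) (mat_app n a x) * dotp n y y)"
proof -
  define S where "S = {x :: nat \<Rightarrow> real. dotp n x x = 1 \<and> (\<forall>i<k. dotp n (v i) x = 0) \<and> (\<forall>i\<ge>n. x i = 0)}"
  define q where "q x = dotp n (mat_app n a x) (mat_app n a x)" for x
  have "continuous_on S q"
  proof (rule continuous_on_subset)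
    show "continuous_on UNIV q"
      unfolding q_def mat_app_def
      by (intro continuous_on_dotp continuous_on_sum continuous_on_mult continuous_on_const
          continuous_on_product_coordinates)
  qed simp
  moreover have "S \<noteq> {}"
    using ex_orthogonal_unit[OF assms] by (simp add: S_def)
  moreover have "compact S"
    unfolding S_def by (rule compact_orthogonal_units)
  ultimately obtain x where x: "x \<in> S" "\<forall>y\<in>S. q y \<le> q x"
    using continuous_attains_sup by metis
  have "q y \<le> q x * dotp n y y" if y: "\<forall>i<k. dotp n (v i) y = 0" for y
  proof (cases "dotp n y y = 0")
    case True
    then have "\<forall>i<n. y i = 0" using dotp_eq_0 by blast
    then have "q y = 0" by (simp add: q_def mat_app_def dotp_def)
    then show ?thesis using True by simp
  next
    case False
    then have pos: "dotp n y y > 0" using dotp_nonneg[of n y] by linarith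
    define z where "z = (\<lambda>d. if d < n then (1 / sqrt (dotp n y y)) * y d else 0)"
    have z: "dotp n w z = dotp n w y / sqrt (dotp n y y)" for w
    proof -
      have "dotp n w z = dotp n w (\<lambda>d. (1 / sqrt (dotp n y y)) * y d)"
        by (rule dotp_cong) (auto simp: z_def)
      then show ?thesis by (simp only: dotp_scale_right) simp
    qed
    have "dotp n z z = dotp n y z / sqrt (dotp n y y)" by (subst z) (simp add: dotp_commute)
    also have "\<dots> = 1" using pos by (simp add: z real_div_sqrt)
    finally have "z \<in> S" using y by (simp add: S_def z) (simp add: z_def)
    then have "q z \<le> q x" using x(2) by blast
    moreover have "mat_app n a z = mat_app n a (\<lambda>d. (1 / sqrt (dotp n y y)) * y d)"
      by (auto simp: mat_app_def z_def intro!: sum.cong)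
    then have "q z = q y / dotp n y y"
      unfolding q_def using pos
      by (simp only: mat_app_scale dotp_scale_left dotp_scale_right) simp
    ultimately show ?thesis using pos by (simp add: field_simps)
  qed
  then show ?thesis using x(1) unfolding q_def S_def by blast
qed

lemma ex_greedy_basis:
  "k \<le> n \<Longrightarrow> \<exists>v. orthonormal n k v \<and>
     (\<forall>j<k. \<forall>y. (\<forall>i<j. dotp n (v i) y = 0) \<longrightarrow>
       dotp n (mat_app n a y) (mat_app n a y) \<le> dotp n (mat_app n a (v j)) (mat_app n a (v j)) * dotp n y y)"
proof (induction k)
  case 0
  then show ?case by (auto simp: orthonormal_def)
next
  case (Suc k)
  then obtain v where v: "orthonormal n k v" and
    max: "\<forall>j<k. \<forall>y. (\<forall>i<j. dotp n (v i) y = 0) \<longrightarrow>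
       dotp n (mat_app n a y) (mat_app n a y) \<le> dotp n (mat_app n a (v j)) (mat_app n a (v j)) * dotp n y y"
    by auto
  have "k < n" using Suc.prems by simp
  then obtain x where x: "dotp n x x = 1" "\<forall>i<k. dotp n (v i) x = 0"
    "\<forall>y. (\<forall>i<k. dotp n (v i) y = 0) \<longrightarrow>
       dotp n (mat_app n a y) (mat_app n a y) \<le> dotp n (mat_app n a x) (mat_app n a x) * dotp n y y"
    using ex_max_stretch[OF v, of a] by blast
  have "\<forall>i<k. dotp n x (v i) = 0" using x(2) by (metis dotp_commute)
  then have orth: "orthonormal n (Suc k) (v(k := x))"
    using v x by (auto simp: orthonormal_def less_Suc_eq)
  show ?case
    by (intro exI conjI, rule orth) (use max x(3) in \<open>auto simp: less_Suc_eq\<close>)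
qed

text \<open>Choosing each right singular vector as a maximiser of the stretch on the orthogonal
  complement of the previous ones makes the images orthogonal by first-order optimality.\<close>

lemma ex_svd_fun:
  obtains u v \<sigma> where "orthonormal n n u" "orthonormal n n v"
    "\<And>i. i < n \<Longrightarrow> \<sigma> i \<ge> (0::real)" "\<And>i j. i \<le> j \<Longrightarrow> j < n \<Longrightarrow> \<sigma> j \<le> \<sigma> i"
    "\<And>x y. x < n \<Longrightarrow> y < n \<Longrightarrow> a x y = (\<Sum>i<n. \<sigma> i * u i x * v i y)"
proof -
  obtain v where v: "orthonormal n n v" and
    max: "\<And>j y. j < n \<Longrightarrow> (\<forall>i<j. dotp n (v i) y = 0) \<Longrightarrow>
       dotp n (mat_app n a y) (mat_app n a y) \<le> dotp n (mat_app n a (v j)) (mat_app n a (v j)) * dotp n y y"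
    using ex_greedy_basis[of n n a] by blast
  define w where "w i = mat_app n a (v i)" for i
  define \<sigma> where "\<sigma> i = sqrt (dotp n (w i) (w i))" for i
  have vv: "dotp n (v i) (v j) = (if i = j then 1 else 0)" if "i < n" "j < n" for i j
    using v that by (auto simp: orthonormal_def)
  have dec: "\<sigma> j \<le> \<sigma> i" if "i \<le> j" "j < n" for i j
    using max[of i "v j"] that by (auto simp: \<sigma>_def w_def vv)
  have orth: "dotp n (w i) (w j) = 0" if ij: "i < j" "j < n" for i j
  proof (rule ccontr)
    define p where "p = dotp n (w i) (w j)"
    assume "dotp n (w i) (w j) \<noteq> 0"
    then have p: "p \<noteq> 0" by (simp add: p_def)
    \<comment> \<open>The test vector is \<open>v i + b * v j\<close>. Maximality will give
      \<open>2 * b * p \<le> b^2 * D\<close>, which fails for small \<open>b\<close> of the sign of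
      \<open>p\<close>; the chosen \<open>b\<close> makes \<open>b^2 * D\<close> at most
      \<open>b * p\<close>, and the added 1 covers \<open>D = 0\<close>.\<close>
    define D where "D = dotp n (w i) (w i) - dotp n (w j) (w j)"
    define b where "b = p / (\<bar>D\<bar> + 1)"
    have "dotp n (mat_app n a (\<lambda>c. v i c + b * v j c)) (mat_app n a (\<lambda>c. v i c + b * v j c))
      \<le> dotp n (w i) (w i) * dotp n (\<lambda>c. v i c + b * v j c) (\<lambda>c. v i c + b * v j c)"
      using max[of i "\<lambda>c. v i c + b * v j c"] ij
      by (simp add: dotp_add_right dotp_scale_right vv w_def)
    moreover have "dotp n (\<lambda>c. v i c + b * v j c) (\<lambda>c. v i c + b * v j c) = 1 + b\<^sup>2"
      using ij by (simp add: dotp_add_right dotp_add_left dotp_scale_right dotp_scale_left vv power2_eq_square)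
    moreover have "dotp n (mat_app n a (\<lambda>c. v i c + b * v j c)) (mat_app n a (\<lambda>c. v i c + b * v j c))
      = dotp n (w i) (w i) + 2 * b * p + b\<^sup>2 * dotp n (w j) (w j)"
      unfolding mat_app_add mat_app_scale w_def[symmetric] p_def
      by (simp add: dotp_add_right dotp_add_left dotp_scale_right dotp_scale_left
            dotp_commute[of n "w j" "w i"] power2_eq_square algebra_simps)
    ultimately have le: "2 * b * p \<le> b\<^sup>2 * D"
      by (simp add: D_def algebra_simps)
    have "b * p > 0" using p unfolding b_def by (simp add: zero_less_mult_iff divide_simps) argo
    have "b\<^sup>2 * D \<le> b\<^sup>2 * (\<bar>D\<bar> + 1)" by (intro mult_left_mono) auto
    also have "\<dots> = b * p" by (simp add: b_def power2_eq_square)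
    finally show False using le \<open>b * p > 0\<close> by linarith
  qed
  \<comment> \<open>\<open>r\<close> is the rank: the \<sigma> decrease, so the positive ones form
    an initial segment, where the images can be normalised.\<close>
  have "\<exists>r\<le>n. \<forall>i<n. \<sigma> i > 0 \<longleftrightarrow> i < r"
  proof (cases "\<exists>i<n. \<not> \<sigma> i > 0")
    case True
    define r where "r = (LEAST i. i < n \<and> \<not> \<sigma> i > 0)"
    have r: "r < n" "\<not> \<sigma> r > 0" using LeastI_ex[OF True] by (auto simp: r_def)
    moreover have "\<sigma> i > 0" if "i < r" for i
      using not_less_Least[of i "\<lambda>i. i < n \<and> \<not> \<sigma> i > 0"] that r by (auto simp: r_def)
    ultimately show ?thesis
      using dec by (intro exI[of _ r]) (metis less_imp_le not_le order.strict_trans2)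
  qed auto
  then obtain r where r: "r \<le> n" "\<And>i. i < n \<Longrightarrow> \<sigma> i > 0 \<longleftrightarrow> i < r" by blast
  have ww: "dotp n (w i) (w j) = (if i = j then (\<sigma> i)\<^sup>2 else 0)" if "i < n" "j < n" for i j
    using orth[of i j] orth[of j i] that dotp_commute[of n "w i" "w j"] dotp_nonneg[of n "w i"]
    by (cases i j rule: linorder_cases) (auto simp: \<sigma>_def)
  have "orthonormal n r (\<lambda>i c. (1 / \<sigma> i) * w i c)"
    unfolding orthonormal_def dotp_scale_left dotp_scale_right
    using r by (auto simp: ww power2_eq_square) (metis less_le_trans less_irrefl)
  then obtain u where u: "orthonormal n n u" "\<And>i. i < r \<Longrightarrow> u i = (\<lambda>c. (1 / \<sigma> i) * w i c)"
    using orthonormal_extend r(1) by blast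
  have wu: "w i x = \<sigma> i * u i x" if "i < n" "x < n" for i x
  proof (cases "i < r")
    case True
    then show ?thesis using u(2)[OF True] r(2)[OF that(1)] by simp
  next
    case False
    then have "\<sigma> i = 0"
      using r(2)[OF that(1)] dotp_nonneg[of n "w i"] unfolding \<sigma>_def by (simp add: not_less)
    then show ?thesis using dotp_eq_0[of n "w i" x] that by (simp add: \<sigma>_def)
  qed
  have a: "a x y = (\<Sum>i<n. \<sigma> i * u i x * v i y)" if "x < n" "y < n" for x y
  proof -
    have "a x y = (\<Sum>i<n. dotp n (v i) (a x) * v i y)"
      by (rule orthonormal_expand(1)[OF v that(2)])
    also have "\<dots> = (\<Sum>i<n. w i x * v i y)"
      by (simp add: w_def mat_app_def dotp_def mult.commute)
    finally show ?thesis using wu that by simp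
  qed
  show ?thesis
  proof (rule that[OF u(1) v])
    show "0 \<le> \<sigma> i" for i by (simp add: \<sigma>_def dotp_nonneg)
  qed (fact dec a)+
qed

lemma norm_orthonormal_combination:
  assumes "orthonormal n m v"
  shows "dotp n (\<lambda>c. \<Sum>i<m. r i * v i c) (\<lambda>c. \<Sum>i<m. r i * v i c) = (\<Sum>i<m. (r i)\<^sup>2)"
proof -
  have "dotp n (\<lambda>c. \<Sum>i<m. r i * v i c) (v j) = r j" if "j < m" for j
  proof -
    have "dotp n (v j) (\<lambda>c. \<Sum>i<m. r i * v i c) = (\<Sum>i<m. if i = j then r i else 0)"
      unfolding dotp_sum_right dotp_scale_right
      using assms that by (intro sum.cong) (auto simp: orthonormal_def)
    then show ?thesis using that by (simp add: dotp_commute)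
  qed
  then show ?thesis
    unfolding dotp_sum_right dotp_scale_right by (simp add: power2_eq_square)
qed

section \<open>From matrices to singular values: the error as a tail sum\<close>

lemma diag_product_entry:
  fixes U S V :: "real mat"
  assumes "U \<in> carrier_mat n n" "S \<in> carrier_mat n n" "V \<in> carrier_mat n n" "diagonal_mat S"
    and "x < n" "y < n"
  shows "(U * S * transpose_mat V) $$ (x, y) = (\<Sum>i<n. S $$ (i, i) * U $$ (x, i) * V $$ (y, i))"
proof -
  have "(U * S) $$ (x, i) = S $$ (i, i) * U $$ (x, i)" if "i < n" for i
  proof -
    have "(U * S) $$ (x, i) = (\<Sum>j<n. U $$ (x, j) * S $$ (j, i))"
      using assms that by (simp add: scalar_prod_def lessThan_atLeast0)
    also have "\<dots> = (\<Sum>j<n. if j = i then S $$ (i, i) * U $$ (x, i) else 0)"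
      using assms that by (intro sum.cong) (auto simp: diagonal_mat_def)
    finally show ?thesis using that by simp
  qed
  moreover have "(U * S * transpose_mat V) $$ (x, y) = (\<Sum>i<n. (U * S) $$ (x, i) * V $$ (y, i))"
  proof -
    have "(U * S * transpose_mat V) $$ (x, y) = row (U * S) x \<bullet> col (transpose_mat V) y"
      using assms by (intro index_mult_mat(1)) auto
    also have "\<dots> = (\<Sum>i<n. (U * S) $$ (x, i) * V $$ (y, i))"
      unfolding scalar_prod_def using assms
      by (intro sum.cong) auto
    finally show ?thesis .
  qed
  ultimately show ?thesis by simp
qed

lemma orthonormal_mat_iff:
  assumes "U \<in> carrier_mat n n"
  shows "orthonormal_mat n U \<longleftrightarrow> orthonormal n n (\<lambda>i x. U $$ (x, i))"
proof -
  have "(transpose_mat U * U) $$ (i, j) = dotp n (\<lambda>x. U $$ (x, i)) (\<lambda>x. U $$ (x, j))"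
    if "i < n" "j < n" for i j
    using assms that by (simp add: scalar_prod_def dotp_def lessThan_atLeast0)
  then show ?thesis
    using assms by (auto simp: orthonormal_mat_def orthonormal_def mat_eq_iff)
qed

lemma ex_svd:
  assumes A: "A \<in> carrier_mat n n"
  shows "\<exists>U S V. is_svd A U S V"
proof -
  obtain u v \<sigma> where uv: "orthonormal n n u" "orthonormal n n v"
    and \<sigma>: "\<And>i. i < n \<Longrightarrow> \<sigma> i \<ge> (0::real)" "\<And>i j. i \<le> j \<Longrightarrow> j < n \<Longrightarrow> \<sigma> j \<le> \<sigma> i"
    and a: "\<And>x y. x < n \<Longrightarrow> y < n \<Longrightarrow> A $$ (x, y) = (\<Sum>i<n. \<sigma> i * u i x * v i y)"
    by (rule ex_svd_fun[of n "\<lambda>x y. A $$ (x, y)"]) blast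
  define U where "U = Matrix.mat n n (\<lambda>(x, i). u i x)"
  define V where "V = Matrix.mat n n (\<lambda>(x, i). v i x)"
  define S where "S = Matrix.mat n n (\<lambda>(i, j). if i = j then \<sigma> i else 0)"
  have carr: "U \<in> carrier_mat n n" "V \<in> carrier_mat n n" "S \<in> carrier_mat n n"
    by (auto simp: U_def V_def S_def)
  have diag: "diagonal_mat S" by (auto simp: diagonal_mat_def S_def)
  have "orthonormal n n (\<lambda>i x. U $$ (x, i))" "orthonormal n n (\<lambda>i x. V $$ (x, i))"
    using uv by (auto simp: U_def V_def orthonormal_def dotp_def)
  then have "orthonormal_mat n U" "orthonormal_mat n V"
    using carr by (auto simp: orthonormal_mat_iff)
  moreover have "A = U * S * transpose_mat V"
  proof (rule eq_matI)
    fix x y assume "x < dim_row (U * S * transpose_mat V)" "y < dim_col (U * S * transpose_mat V)"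
    then have xy: "x < n" "y < n" using carr by auto
    show "A $$ (x, y) = (U * S * transpose_mat V) $$ (x, y)"
      unfolding diag_product_entry[OF carr(1,3,2) diag xy] a[OF xy]
      using xy by (intro sum.cong) (auto simp: U_def V_def S_def)
  qed (use A carr in auto)
  ultimately have "is_svd A U S V"
    using A carr diag \<sigma> by (auto simp: is_svd_def S_def)
  then show ?thesis by blast
qed

text \<open>Facts about the chosen \<open>truncated_svd\<close> are read off the decomposition
  behind it. Subtraction leaves the terms of index at least \<open>s\<close>, and orthonormality
  turns their Frobenius norm into the tail sum.\<close>

lemma lowrank_error_tail:
  assumes A: "A \<in> carrier_mat n n"
  obtains u v \<sigma> where "orthonormal n n u" "orthonormal n n v"
    "\<And>i. i < n \<Longrightarrow> \<sigma> i \<ge> (0::real)" "\<And>i j. i \<le> j \<Longrightarrow> j < n \<Longrightarrow> \<sigma> j \<le> \<sigma> i"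
    "\<And>x y. x < n \<Longrightarrow> y < n \<Longrightarrow> A $$ (x, y) = (\<Sum>i<n. \<sigma> i * u i x * v i y)"
    "lowrank_error s A = (\<Sum>i<n. if i < s then 0 else (\<sigma> i)\<^sup>2)"
proof -
  have "\<exists>B. is_truncated_svd s A B"
    using ex_svd[OF A] by (auto simp: is_truncated_svd_def)
  then have "is_truncated_svd s A (truncated_svd s A)"
    unfolding truncated_svd_def by (rule someI_ex)
  then obtain U S V where svd: "is_svd A U S V"
    and B: "truncated_svd s A = U * keep_leading_diag s S * transpose_mat V"
    by (auto simp: is_truncated_svd_def)
  have carr: "U \<in> carrier_mat n n" "V \<in> carrier_mat n n" "S \<in> carrier_mat n n"
    using svd A by (auto simp: is_svd_def orthonormal_mat_def)
  have carr': "keep_leading_diag s S \<in> carrier_mat n n"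
    using carr by (auto simp: keep_leading_diag_def)
  have diag: "diagonal_mat S" using svd by (simp add: is_svd_def)
  have diag': "diagonal_mat (keep_leading_diag s S)"
    by (auto simp: diagonal_mat_def keep_leading_diag_def)
  define u where "u i x = U $$ (x, i)" for i x
  define v where "v i x = V $$ (x, i)" for i x
  define \<sigma> where "\<sigma> i = S $$ (i, i)" for i
  have orth: "orthonormal n n u" "orthonormal n n v"
    using svd A carr unfolding u_def v_def by (auto simp: is_svd_def orthonormal_mat_iff)
  have a: "A $$ (x, y) = (\<Sum>i<n. \<sigma> i * u i x * v i y)" if "x < n" "y < n" for x y
    using svd diag_product_entry[OF carr(1,3,2) diag that] by (simp add: is_svd_def u_def v_def \<sigma>_def)
  define \<tau> where "\<tau> i = (if i < s then 0 else \<sigma> i)" for i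
  have diff: "(A - truncated_svd s A) $$ (x, y) = (\<Sum>i<n. (\<tau> i * u i x) * v i y)"
    if xy: "x < n" "y < n" for x y
  proof -
    have "(A - truncated_svd s A) $$ (x, y) = A $$ (x, y) - truncated_svd s A $$ (x, y)"
      using xy carr carr' by (simp add: B)
    also have "\<dots> = (\<Sum>i<n. \<sigma> i * u i x * v i y) -
        (\<Sum>i<n. keep_leading_diag s S $$ (i, i) * u i x * v i y)"
      unfolding B a[OF xy] diag_product_entry[OF carr(1) carr' carr(2) diag' xy] u_def v_def ..
    also have "\<dots> = (\<Sum>i<n. (\<tau> i * u i x) * v i y)"
      unfolding sum_subtractf[symmetric] using carr
      by (intro sum.cong) (auto simp: keep_leading_diag_def \<tau>_def \<sigma>_def)
    finally show ?thesis .
  qed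
  have dims: "dim_row (A - truncated_svd s A) = n" "dim_col (A - truncated_svd s A) = n"
    using carr carr' by (auto simp: B)
  have "lowrank_error s A = (\<Sum>x<n. \<Sum>y<n. ((A - truncated_svd s A) $$ (x, y))\<^sup>2)"
    unfolding lowrank_error_def frobenius_norm_def dims
    by (simp add: sum_nonneg)
  also have "\<dots> = (\<Sum>x<n. dotp n (\<lambda>y. \<Sum>i<n. (\<tau> i * u i x) * v i y) (\<lambda>y. \<Sum>i<n. (\<tau> i * u i x) * v i y))"
    unfolding dotp_def power2_eq_square by (intro sum.cong) (auto simp only: diff lessThan_iff)
  also have "\<dots> = (\<Sum>i<n. (\<tau> i)\<^sup>2 * dotp n (u i) (u i))"
    unfolding norm_orthonormal_combination[OF orth(2)]
    by (subst sum.swap) (simp add: dotp_def sum_distrib_left power2_eq_square mult_ac)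
  also have "\<dots> = (\<Sum>i<n. if i < s then 0 else (\<sigma> i)\<^sup>2)"
    using orth(1) by (intro sum.cong) (auto simp: orthonormal_def \<tau>_def)
  finally have err: "lowrank_error s A = (\<Sum>i<n. if i < s then 0 else (\<sigma> i)\<^sup>2)" .
  show ?thesis
  proof (rule that[OF orth _ _ a err])
    show "\<sigma> i \<ge> 0" if "i < n" for i
      using svd that carr A by (auto simp: is_svd_def \<sigma>_def)
    show "\<sigma> j \<le> \<sigma> i" if "i \<le> j" "j < n" for i j
      using svd that carr A by (auto simp: is_svd_def \<sigma>_def)
  qed
qed

section \<open>Variational bounds on the rank-s error\<close>

lemma stretch_svd:
  assumes "orthonormal n n u"
    and a: "\<And>x y. x < n \<Longrightarrow> y < n \<Longrightarrow> a x y = (\<Sum>i<n. \<sigma> i * u i x * v i y)"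
  shows "dotp n (mat_app n a w) (mat_app n a w) = (\<Sum>i<n. (\<sigma> i)\<^sup>2 * (dotp n (v i) w)\<^sup>2)"
proof -
  have "mat_app n a w x = (\<Sum>i<n. (\<sigma> i * dotp n (v i) w) * u i x)" if "x < n" for x
  proof -
    have "mat_app n a w x = (\<Sum>y<n. \<Sum>i<n. \<sigma> i * u i x * v i y * w y)"
      unfolding mat_app_def by (intro sum.cong) (auto simp: a that sum_distrib_right)
    also have "\<dots> = (\<Sum>i<n. \<Sum>y<n. \<sigma> i * u i x * v i y * w y)" by (rule sum.swap)
    also have "\<dots> = (\<Sum>i<n. (\<sigma> i * dotp n (v i) w) * u i x)"
      by (simp add: dotp_def sum_distrib_left sum_distrib_right mult_ac)
    finally show ?thesis .
  qed
  then have "dotp n (mat_app n a w) (mat_app n a w) =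
      dotp n (\<lambda>x. \<Sum>i<n. (\<sigma> i * dotp n (v i) w) * u i x) (\<lambda>x. \<Sum>i<n. (\<sigma> i * dotp n (v i) w) * u i x)"
    by (intro dotp_cong)
  also have "\<dots> = (\<Sum>i<n. (\<sigma> i)\<^sup>2 * (dotp n (v i) w)\<^sup>2)"
    unfolding norm_orthonormal_combination[OF assms(1)] by (simp add: power_mult_distrib)
  finally show ?thesis .
qed

lemma frobenius_svd:
  fixes a :: "nat \<Rightarrow> nat \<Rightarrow> real"
  assumes "orthonormal n n u" "orthonormal n n v"
    and a: "\<And>x y. x < n \<Longrightarrow> y < n \<Longrightarrow> a x y = (\<Sum>i<n. \<sigma> i * u i x * v i y)"
  shows "(\<Sum>x<n. \<Sum>y<n. (a x y)\<^sup>2) = (\<Sum>i<n. (\<sigma> i)\<^sup>2)"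
proof -
  have "(\<Sum>x<n. \<Sum>y<n. (a x y)\<^sup>2) =
      (\<Sum>x<n. dotp n (\<lambda>y. \<Sum>i<n. (\<sigma> i * u i x) * v i y) (\<lambda>y. \<Sum>i<n. (\<sigma> i * u i x) * v i y))"
    unfolding dotp_def power2_eq_square by (intro sum.cong) (auto simp only: a lessThan_iff)
  also have "\<dots> = (\<Sum>i<n. (\<sigma> i)\<^sup>2 * dotp n (u i) (u i))"
    unfolding norm_orthonormal_combination[OF assms(2)]
    by (subst sum.swap) (simp add: dotp_def sum_distrib_left power2_eq_square mult_ac)
  also have "\<dots> = (\<Sum>i<n. (\<sigma> i)\<^sup>2)"
    using assms(1) by (intro sum.cong) (auto simp: orthonormal_def)
  finally show ?thesis .
qed

text \<open>A squared singular value is the squared stretch of a right singular vector, hence at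
  most \<kappa>, and truncation removes at most \<open>s\<close> of them from the squared Frobenius
  norm.\<close>

lemma lowrank_error_ge:
  assumes A: "A \<in> carrier_mat n n"
    and op: "\<And>w. dotp n (mat_app n (\<lambda>x y. A $$ (x, y)) w) (mat_app n (\<lambda>x y. A $$ (x, y)) w) \<le> \<kappa> * dotp n w w"
    and "\<kappa> \<ge> 0"
  shows "lowrank_error s A \<ge> (\<Sum>x<n. \<Sum>y<n. (A $$ (x, y))\<^sup>2) - real s * \<kappa>"
proof -
  obtain u v \<sigma> where uv: "orthonormal n n u" "orthonormal n n v"
    and a: "\<And>x y. x < n \<Longrightarrow> y < n \<Longrightarrow> A $$ (x, y) = (\<Sum>i<n. \<sigma> i * u i x * v i y)"
    and err: "lowrank_error s A = (\<Sum>i<n. if i < s then 0 else (\<sigma> i)\<^sup>2)"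
    by (rule lowrank_error_tail[OF A, of s]) blast
  have "(\<sigma> j)\<^sup>2 \<le> \<kappa>" if "j < n" for j
  proof -
    have "(\<Sum>i<n. (\<sigma> i)\<^sup>2 * (dotp n (v i) (v j))\<^sup>2) = (\<Sum>i<n. if i = j then (\<sigma> j)\<^sup>2 else 0)"
      using uv(2) that by (intro sum.cong) (auto simp: orthonormal_def)
    then show ?thesis
      using op[of "v j"] stretch_svd[OF uv(1) a, where w = "v j"] uv(2) that by (simp add: orthonormal_def)
  qed
  then have "(\<Sum>i<n. if i < s then (\<sigma> i)\<^sup>2 else 0) \<le> (\<Sum>i<n. if i < s then \<kappa> else 0)"
    by (intro sum_mono) auto
  also have "\<dots> = real (card {i. i < n \<and> i < s}) * \<kappa>"
    by (simp add: sum.If_cases lessThan_def Collect_conj_eq)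
  also have "\<dots> \<le> real s * \<kappa>"
    using card_mono[of "{..<s}" "{i. i < n \<and> i < s}"] assms(3) by (intro mult_right_mono) auto
  finally have "(\<Sum>i<n. if i < s then (\<sigma> i)\<^sup>2 else 0) \<le> real s * \<kappa>" .
  moreover have "(\<Sum>i<n. (\<sigma> i)\<^sup>2) = (\<Sum>i<n. if i < s then (\<sigma> i)\<^sup>2 else 0) + lowrank_error s A"
    unfolding err sum.distrib[symmetric] by (intro sum.cong) auto
  ultimately show ?thesis using frobenius_svd[OF uv a] by simp
qed

text \<open>Ky Fan's principle. The total stretch of the \<open>w b\<close> weights the squared
  singular values by numbers \<open>p i\<close> in [0, 1] with sum \<open>s\<close>, and the best
  such weighting is the indicator \<theta> of the first \<open>s\<close> indices.\<close>

lemma lowrank_error_le: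
  assumes A: "A \<in> carrier_mat n n" and w: "orthonormal n s w" and s: "1 \<le> s" "s \<le> n"
  shows "lowrank_error s A \<le> (\<Sum>x<n. \<Sum>y<n. (A $$ (x, y))\<^sup>2) -
    (\<Sum>b<s. dotp n (mat_app n (\<lambda>x y. A $$ (x, y)) (w b)) (mat_app n (\<lambda>x y. A $$ (x, y)) (w b)))"
proof -
  obtain u v \<sigma> where uv: "orthonormal n n u" "orthonormal n n v"
    and \<sigma>: "\<And>i. i < n \<Longrightarrow> \<sigma> i \<ge> (0::real)" "\<And>i j. i \<le> j \<Longrightarrow> j < n \<Longrightarrow> \<sigma> j \<le> \<sigma> i"
    and a: "\<And>x y. x < n \<Longrightarrow> y < n \<Longrightarrow> A $$ (x, y) = (\<Sum>i<n. \<sigma> i * u i x * v i y)"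
    and err: "lowrank_error s A = (\<Sum>i<n. if i < s then 0 else (\<sigma> i)\<^sup>2)"
    by (rule lowrank_error_tail[OF A, of s]) blast
  define p where "p i = (\<Sum>b<s. (dotp n (v i) (w b))\<^sup>2)" for i
  define \<theta> where "\<theta> i = (if i < s then 1 else 0 :: real)" for i
  \<comment> \<open>The \<open>s\<close>-th largest squared singular value. Subtracting it is free
    because \<theta> and \<open>p\<close> have equal totals, and it makes the two factors of each
    summand agree in sign.\<close>
  define t where "t = (\<sigma> (s - 1))\<^sup>2"
  have p: "0 \<le> p i" "p i \<le> 1" if "i < n" for i
  proof -
    show "0 \<le> p i" by (simp add: p_def sum_nonneg)
    have "p i = (\<Sum>b<s. (dotp n (w b) (v i))\<^sup>2)" by (simp add: p_def dotp_commute)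
    also have "\<dots> \<le> dotp n (v i) (v i)" by (rule bessel[OF w])
    finally show "p i \<le> 1" using uv(2) that by (simp add: orthonormal_def)
  qed
  have "(\<Sum>i<n. p i) = (\<Sum>b<s. dotp n (w b) (w b))"
    unfolding p_def by (subst sum.swap) (use orthonormal_expand(2)[OF uv(2), of 0] s in simp)
  also have "\<dots> = real s" using w by (simp add: orthonormal_def)
  finally have sum_p: "(\<Sum>i<n. p i) = real s" .
  have "{..<n} \<inter> {i. i < s} = {..<s}" using s by auto
  then have sum_\<theta>: "(\<Sum>i<n. \<theta> i) = real s"
    by (simp add: \<theta>_def sum.If_cases)
  have st: "dotp n (mat_app n (\<lambda>x y. A $$ (x, y)) z) (mat_app n (\<lambda>x y. A $$ (x, y)) z)
      = (\<Sum>i<n. (\<sigma> i)\<^sup>2 * (dotp n (v i) z)\<^sup>2)" for z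
    by (rule stretch_svd[OF uv(1)]) (rule a)
  have "(\<Sum>b<s. dotp n (mat_app n (\<lambda>x y. A $$ (x, y)) (w b)) (mat_app n (\<lambda>x y. A $$ (x, y)) (w b)))
      = (\<Sum>i<n. (\<sigma> i)\<^sup>2 * p i)"
    unfolding st p_def sum_distrib_left by (rule sum.swap)
  moreover have "0 \<le> (\<Sum>i<n. ((\<sigma> i)\<^sup>2 - t) * (\<theta> i - p i))"
  proof (rule sum_nonneg)
    fix i assume "i \<in> {..<n}"
    then have i: "i < n" by simp
    show "0 \<le> ((\<sigma> i)\<^sup>2 - t) * (\<theta> i - p i)"
    proof (cases "i < s")
      case True
      then have "t \<le> (\<sigma> i)\<^sup>2"
        unfolding t_def using \<sigma>(1)[of "s - 1"] \<sigma>(2)[of i "s - 1"] s by (intro power_mono) auto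
      then show ?thesis using p(2)[OF i] True by (simp add: \<theta>_def)
    next
      case False
      then have "(\<sigma> i)\<^sup>2 \<le> t"
        unfolding t_def using \<sigma>(1)[of i] \<sigma>(2)[of "s - 1" i] i by (intro power_mono) auto
      then show ?thesis using p(1)[OF i] False by (simp add: \<theta>_def mult_nonpos_nonneg)
    qed
  qed
  moreover have "(\<Sum>i<n. ((\<sigma> i)\<^sup>2 - t) * (\<theta> i - p i)) =
      (\<Sum>i<n. (\<sigma> i)\<^sup>2 * \<theta> i) - (\<Sum>i<n. (\<sigma> i)\<^sup>2 * p i) - t * ((\<Sum>i<n. \<theta> i) - (\<Sum>i<n. p i))"
    by (simp add: algebra_simps sum.distrib sum_subtractf sum_distrib_left)
  moreover have "(\<Sum>i<n. (\<sigma> i)\<^sup>2) = (\<Sum>i<n. (\<sigma> i)\<^sup>2 * \<theta> i) + lowrank_error s A"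
    unfolding err sum.distrib[symmetric] by (intro sum.cong) (auto simp: \<theta>_def)
  ultimately show ?thesis using frobenius_svd[OF uv a] sum_p sum_\<theta> by simp
qed

section \<open>Blow-ups of signed cycles\<close>

text \<open>The sign of the whole cycle sits on the edge that closes it, from row
  \<open>L - 1\<close> to column 0. The diagonal is the perfect matching that queries have to
  hit.\<close>

definition signed_cycle :: "real \<Rightarrow> nat \<Rightarrow> nat \<Rightarrow> nat \<Rightarrow> real" where
  "signed_cycle e L i j =
     (if j = i then 1 else 0) + (if j = Suc i then 1 else 0) + (if Suc i = L \<and> j = 0 then e else 0)"

text \<open>Labels are pairs of block and position; blocks from \<open>s\<close> on stand for
  leftover rows and columns.\<close>

definition cycle_blocks :: "nat \<Rightarrow> nat \<Rightarrow> real \<Rightarrow> nat \<times> nat \<Rightarrow> nat \<times> nat \<Rightarrow> real" where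
  "cycle_blocks s L e l m =
     (if fst l = fst m \<and> fst l < s then signed_cycle e L (snd l) (snd m) else 0)"

lemma signed_cycle_sum:
  assumes "i < L"
  shows "(\<Sum>j<L. signed_cycle e L i j * X j) = X i + (if Suc i < L then X (Suc i) else e * X 0)"
proof -
  have "(\<Sum>j<L. signed_cycle e L i j * X j) =
      (\<Sum>j<L. if j = i then X j else 0) + (\<Sum>j<L. if j = Suc i then X j else 0) +
      (\<Sum>j<L. if j = 0 then (if Suc i = L then e * X 0 else 0) else 0)"
    unfolding sum.distrib[symmetric] by (intro sum.cong) (auto simp: signed_cycle_def algebra_simps)
  then show ?thesis using assms by auto
qed

lemma signed_cycle_sum_sq:
  assumes "i < L" "2 \<le> L" "e\<^sup>2 = 1"
  shows "(\<Sum>j<L. (signed_cycle e L i j)\<^sup>2) = 2"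
proof -
  have "(\<Sum>j<L. (signed_cycle e L i j)\<^sup>2) =
      (\<Sum>j<L. if j = i then 1 else 0) + (\<Sum>j<L. if j = Suc i then 1 else 0) +
      (\<Sum>j<L. if j = 0 then (if Suc i = L then 1 else 0) else 0)"
    unfolding sum.distrib[symmetric] using assms
    by (intro sum.cong) (auto simp: signed_cycle_def)
  then show ?thesis using assms by auto
qed

text \<open>The cycle is frustrated: running once around it flips the sign, so twice any value is a
  signed sum of the differences along the cycle.\<close>

lemma frustrated_cycle_norm:
  fixes X :: "nat \<Rightarrow> real"
  assumes "0 < L"
  shows "(\<Sum>i<L. (X i + (if Suc i < L then X (Suc i) else - 1 * X 0))\<^sup>2)
    \<le> (4 - 4 / (real L)\<^sup>2) * (\<Sum>i<L. (X i)\<^sup>2)"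
proof -
  \<comment> \<open>\<open>Y\<close> continues the vector one step past the end with flipped sign,
    so the closing edge becomes an ordinary step.\<close>
  define Y where "Y k = (if k < L then X k else - X 0)" for k
  define d where "d k = Y k - Y (Suc k)" for k
  define S where "S = (\<Sum>i<L. (X i)\<^sup>2)"
  define D where "D = (\<Sum>i<L. (d i)\<^sup>2)"
  obtain M where M: "L = Suc M" using assms gr0_conv_Suc by blast
  have S0: "(\<Sum>i<L. (Y i)\<^sup>2) = S" by (simp add: S_def Y_def)
  have S1: "(\<Sum>i<L. (Y (Suc i))\<^sup>2) = S"
  proof -
    have "(\<Sum>i<L. (Y (Suc i))\<^sup>2) = (\<Sum>i<M. (Y (Suc i))\<^sup>2) + (Y 0)\<^sup>2"
      by (simp add: M Y_def)
    also have "\<dots> = (\<Sum>i<Suc M. (Y i)\<^sup>2)"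
      by (simp add: sum.lessThan_Suc_shift del: sum.lessThan_Suc)
    finally show ?thesis using S0 by (simp only: M)
  qed
  have "(X i + (if Suc i < L then X (Suc i) else - 1 * X 0))\<^sup>2 =
      2 * (Y i)\<^sup>2 + 2 * (Y (Suc i))\<^sup>2 - (d i)\<^sup>2" if "i < L" for i
    using that by (simp add: Y_def d_def power2_eq_square algebra_simps)
  then have "(\<Sum>i<L. (X i + (if Suc i < L then X (Suc i) else - 1 * X 0))\<^sup>2) =
      (\<Sum>i<L. 2 * (Y i)\<^sup>2 + 2 * (Y (Suc i))\<^sup>2 - (d i)\<^sup>2)"
    by (intro sum.cong) auto
  also have "\<dots> = 2 * (\<Sum>i<L. (Y i)\<^sup>2) + 2 * (\<Sum>i<L. (Y (Suc i))\<^sup>2) - D"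
    by (simp add: sum.distrib sum_subtractf sum_distrib_left D_def)
  also have "\<dots> = 4 * S - D" using S0 S1 by simp
  finally have main: "(\<Sum>i<L. (X i + (if Suc i < L then X (Suc i) else - 1 * X 0))\<^sup>2) = 4 * S - D" .
  have "4 * (X i)\<^sup>2 \<le> real L * D" if i: "i < L" for i
  proof -
    have tele: "(\<Sum>j<m. d j) = Y 0 - Y m" for m
      by (induction m) (auto simp: d_def)
    \<comment> \<open>The signs telescope to \<open>2 * Y i - Y 0 - Y L\<close>, where frustration
      cancels the last two terms. Cauchy-Schwarz then costs a factor \<open>L\<close>, summing over
      \<open>i\<close> another.\<close>
    have "(\<Sum>j<L. (if j < i then - 1 else 1) * d j) = (\<Sum>j<L. d j) - 2 * (\<Sum>j<L. if j < i then d j else 0)"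
      unfolding sum_distrib_left sum_subtractf[symmetric] by (intro sum.cong) auto
    also have "(\<Sum>j<L. if j < i then d j else 0) = (\<Sum>j<i. d j)"
      using i by (simp add: sum.If_cases) (intro sum.cong, auto)
    finally have "(\<Sum>j<L. (if j < i then - 1 else 1) * d j) = 2 * X i"
      using i assms by (simp add: tele Y_def)
    then have "4 * (X i)\<^sup>2 = (\<Sum>j<L. (if j < i then - 1 else 1) * d j)\<^sup>2"
      by (simp add: power_mult_distrib)
    also have "\<dots> \<le> (\<Sum>j<L. ((if j < i then - 1 else 1) * d j)\<^sup>2) * real (card {..<L})"
      by (rule sum_squared_le_sum_of_squares)
    also have "\<dots> = real L * D"
      by (simp add: D_def power_mult_distrib if_distrib[of "\<lambda>x. x\<^sup>2"] cong: if_cong)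
    finally show ?thesis .
  qed
  then have "(\<Sum>i<L. 4 * (X i)\<^sup>2) \<le> (\<Sum>i<L. real L * D)"
    by (intro sum_mono) auto
  then have "4 * S \<le> (real L)\<^sup>2 * D"
    by (simp add: S_def sum_distrib_left power2_eq_square)
  then have "4 / (real L)\<^sup>2 * S \<le> D"
    using assms by (simp add: divide_simps mult_ac)
  then show ?thesis
    unfolding main S_def[symmetric] by (simp add: algebra_simps)
qed

text \<open>The estimates use only the modulus of the weights and the sizes of the label classes, so
  one proof serves all permutations and signs.\<close>

locale cycle_blowup =
  fixes n s L N :: nat and \<mu> :: real and r c :: "nat \<Rightarrow> real" and \<rho> \<kappa> :: "nat \<Rightarrow> nat \<times> nat"
  assumes r: "\<And>x. (r x)\<^sup>2 = \<mu>" and c: "\<And>y. (c y)\<^sup>2 = 1"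
    and \<rho>: "\<And>x. snd (\<rho> x) < L" and \<kappa>: "\<And>y. snd (\<kappa> y) < L"
    and card_\<rho>: "\<And>b i. b < s \<Longrightarrow> i < L \<Longrightarrow> card {x. x < n \<and> \<rho> x = (b, i)} = N"
    and card_\<kappa>: "\<And>b i. b < s \<Longrightarrow> i < L \<Longrightarrow> card {y. y < n \<and> \<kappa> y = (b, i)} = N"
    and L: "2 \<le> L" and N: "0 < N"
begin

definition entry :: "real \<Rightarrow> nat \<Rightarrow> nat \<Rightarrow> real" where
  "entry e x y = r x * c y * cycle_blocks s L e (\<rho> x) (\<kappa> y)"

lemma sum_by_label:
  fixes g :: "nat \<Rightarrow> real" and lb :: "nat \<Rightarrow> nat \<times> nat"
  assumes "\<And>x. snd (lb x) < L" "\<And>x. x < n \<Longrightarrow> fst (lb x) \<ge> s \<Longrightarrow> g x = 0"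
  shows "(\<Sum>x<n. g x) = (\<Sum>b<s. \<Sum>i<L. \<Sum>x | x < n \<and> lb x = (b, i). g x)"
proof -
  let ?S = "{x. x < n \<and> fst (lb x) < s}" and ?T = "{..<s} \<times> {..<L}"
  have "(\<Sum>x<n. g x) = (\<Sum>x\<in>?S. g x)"
    using assms(2) by (intro sum.mono_neutral_right) (auto simp flip: not_less)
  also have "\<dots> = (\<Sum>l\<in>?T. \<Sum>x | x \<in> ?S \<and> lb x = l. g x)"
    by (intro sum.group[symmetric] image_subsetI) (use assms(1) in \<open>simp_all add: mem_Times_iff\<close>)
  also have "\<dots> = (\<Sum>b<s. \<Sum>i<L. \<Sum>x | x \<in> ?S \<and> lb x = (b, i). g x)"
    by (simp add: sum.cartesian_product)
  also have "\<dots> = (\<Sum>b<s. \<Sum>i<L. \<Sum>x | x < n \<and> lb x = (b, i). g x)"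
    by (intro sum.cong) auto
  finally show ?thesis .
qed

lemma sum_row_labels:
  fixes h :: "nat \<times> nat \<Rightarrow> real"
  assumes "\<And>l. fst l \<ge> s \<Longrightarrow> h l = 0"
  shows "(\<Sum>x<n. h (\<rho> x)) = real N * (\<Sum>b<s. \<Sum>i<L. h (b, i))"
proof -
  have "(\<Sum>x<n. h (\<rho> x)) = (\<Sum>b<s. \<Sum>i<L. \<Sum>x | x < n \<and> \<rho> x = (b, i). h (\<rho> x))"
    using assms \<rho> by (intro sum_by_label) auto
  also have "\<dots> = (\<Sum>b<s. \<Sum>i<L. \<Sum>x | x < n \<and> \<rho> x = (b, i). h (b, i))"
    by (intro sum.cong) auto
  also have "\<dots> = (\<Sum>b<s. \<Sum>i<L. real N * h (b, i))"
    by (intro sum.cong) (auto simp: card_\<rho>)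
  finally show ?thesis by (simp add: sum_distrib_left)
qed

lemma sum_col_labels:
  fixes h :: "nat \<times> nat \<Rightarrow> real"
  assumes "\<And>l. fst l \<ge> s \<Longrightarrow> h l = 0"
  shows "(\<Sum>y<n. h (\<kappa> y)) = real N * (\<Sum>b<s. \<Sum>i<L. h (b, i))"
proof -
  \<comment> \<open>Column data in the role of row data; these weights have square 1, so \<mu>
    becomes 1.\<close>
  interpret T: cycle_blowup n s L N 1 c c \<kappa> \<kappa>
    by unfold_locales (use c \<kappa> card_\<kappa> L N in auto)
  show ?thesis by (rule T.sum_row_labels[OF assms])
qed

text \<open>The blow-up sees a vector only through these signed sums over label classes, on which it
  acts as the bare cycle.\<close>

definition col_sum :: "(nat \<Rightarrow> real) \<Rightarrow> nat \<Rightarrow> nat \<Rightarrow> real" where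
  "col_sum w b j = (\<Sum>y | y < n \<and> \<kappa> y = (b, j). c y * w y)"

lemma stretch_entry:
  "dotp n (mat_app n (entry e) w) (mat_app n (entry e) w) = \<mu> * real N * (\<Sum>b<s. \<Sum>i<L.
     (col_sum w b i + (if Suc i < L then col_sum w b (Suc i) else e * col_sum w b 0))\<^sup>2)"
proof -
  define h where "h l = (\<Sum>y<n. c y * w y * cycle_blocks s L e l (\<kappa> y))" for l
  have h: "h (b, i) = col_sum w b i + (if Suc i < L then col_sum w b (Suc i) else e * col_sum w b 0)"
    if b: "b < s" and i: "i < L" for b i
  proof -
    have "h (b, i) = (\<Sum>b'<s. \<Sum>j<L. \<Sum>y | y < n \<and> \<kappa> y = (b', j). c y * w y * cycle_blocks s L e (b, i) (\<kappa> y))"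
      unfolding h_def using \<kappa> by (intro sum_by_label) (auto simp: cycle_blocks_def)
    also have "\<dots> = (\<Sum>b'<s. \<Sum>j<L. cycle_blocks s L e (b, i) (b', j) * col_sum w b' j)"
      by (intro sum.cong) (auto simp: col_sum_def sum_distrib_left mult_ac)
    also have "\<dots> = (\<Sum>b'<s. if b' = b then \<Sum>j<L. signed_cycle e L i j * col_sum w b j else 0)"
      using b by (intro sum.cong) (auto simp: cycle_blocks_def)
    finally show ?thesis using b signed_cycle_sum[OF i] by simp
  qed
  have "mat_app n (entry e) w x = r x * h (\<rho> x)" for x
    by (simp add: mat_app_def entry_def h_def sum_distrib_left mult_ac)
  then have "dotp n (mat_app n (entry e) w) (mat_app n (entry e) w) = (\<Sum>x<n. (r x)\<^sup>2 * (h (\<rho> x))\<^sup>2)"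
    by (simp add: dotp_def power2_eq_square mult_ac)
  also have "\<dots> = (\<Sum>x<n. \<mu> * (h (\<rho> x))\<^sup>2)" by (simp only: r)
  also have "\<dots> = real N * (\<Sum>b<s. \<Sum>i<L. \<mu> * (h (b, i))\<^sup>2)"
    by (rule sum_row_labels) (simp add: h_def cycle_blocks_def)
  also have "\<dots> = \<mu> * real N * (\<Sum>b<s. \<Sum>i<L. (h (b, i))\<^sup>2)"
    by (simp add: sum_distrib_left mult_ac)
  also have "(\<Sum>b<s. \<Sum>i<L. (h (b, i))\<^sup>2) = (\<Sum>b<s. \<Sum>i<L.
     (col_sum w b i + (if Suc i < L then col_sum w b (Suc i) else e * col_sum w b 0))\<^sup>2)"
    by (intro sum.cong) (auto simp: h)
  finally show ?thesis .
qed

lemma frobenius_entry: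
  assumes "e\<^sup>2 = 1"
  shows "(\<Sum>x<n. \<Sum>y<n. (entry e x y)\<^sup>2) = \<mu> * (real N)\<^sup>2 * real s * (2 * real L)"
proof -
  have inner: "(\<Sum>y<n. (cycle_blocks s L e (b, i) (\<kappa> y))\<^sup>2) = 2 * real N" if b: "b < s" and i: "i < L" for b i
  proof -
    have "(\<Sum>y<n. (cycle_blocks s L e (b, i) (\<kappa> y))\<^sup>2) =
        real N * (\<Sum>b'<s. \<Sum>j<L. (cycle_blocks s L e (b, i) (b', j))\<^sup>2)"
      by (rule sum_col_labels) (auto simp: cycle_blocks_def)
    also have "(\<Sum>b'<s. \<Sum>j<L. (cycle_blocks s L e (b, i) (b', j))\<^sup>2) =
        (\<Sum>b'<s. if b' = b then \<Sum>j<L. (signed_cycle e L i j)\<^sup>2 else 0)"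
      using b by (intro sum.cong) (auto simp: cycle_blocks_def)
    finally show ?thesis using b signed_cycle_sum_sq[OF i L assms] by simp
  qed
  have "(\<Sum>x<n. \<Sum>y<n. (entry e x y)\<^sup>2) = (\<Sum>x<n. \<mu> * (\<Sum>y<n. (cycle_blocks s L e (\<rho> x) (\<kappa> y))\<^sup>2))"
    by (simp add: entry_def power_mult_distrib r c sum_distrib_left)
  also have "\<dots> = real N * (\<Sum>b<s. \<Sum>i<L. \<mu> * (\<Sum>y<n. (cycle_blocks s L e (b, i) (\<kappa> y))\<^sup>2))"
    by (rule sum_row_labels) (simp add: cycle_blocks_def)
  also have "\<dots> = real N * (\<Sum>b<s. \<Sum>i<L. \<mu> * (2 * real N))"
    using inner by simp
  finally show ?thesis by (simp add: power2_eq_square)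
qed

text \<open>One factor \<open>N\<close> comes from repeated rows, the other from Cauchy-Schwarz over
  the \<open>N\<close> columns of a label; the rest is the norm of the frustrated cycle.\<close>

lemma stretch_frustrated:
  "dotp n (mat_app n (entry (- 1)) w) (mat_app n (entry (- 1)) w)
    \<le> \<mu> * (real N)\<^sup>2 * (4 - 4 / (real L)\<^sup>2) * dotp n w w"
proof -
  let ?\<gamma> = "4 - 4 / (real L)\<^sup>2"
  have \<mu>: "\<mu> \<ge> 0" using r[of 0] zero_le_power2[of "r 0"] by simp
  have "1 \<le> (real L)\<^sup>2" using L by (intro one_le_power) simp
  then have \<gamma>: "?\<gamma> \<ge> 0" using L by (simp add: divide_simps)
  have X: "(col_sum w b i)\<^sup>2 \<le> real N * (\<Sum>y | y < n \<and> \<kappa> y = (b, i). (w y)\<^sup>2)"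
    if "b < s" "i < L" for b i
  proof -
    have "(col_sum w b i)\<^sup>2 \<le> (\<Sum>y | y < n \<and> \<kappa> y = (b, i). (c y * w y)\<^sup>2) * real (card {y. y < n \<and> \<kappa> y = (b, i)})"
      unfolding col_sum_def by (rule sum_squared_le_sum_of_squares)
    then show ?thesis using that by (simp add: card_\<kappa> power_mult_distrib c mult.commute)
  qed
  have "(\<Sum>b<s. \<Sum>i<L. (col_sum w b i + (if Suc i < L then col_sum w b (Suc i) else - 1 * col_sum w b 0))\<^sup>2)
      \<le> (\<Sum>b<s. ?\<gamma> * (\<Sum>i<L. (col_sum w b i)\<^sup>2))"
    using L by (intro sum_mono frustrated_cycle_norm) auto
  also have "\<dots> \<le> (\<Sum>b<s. ?\<gamma> * (\<Sum>i<L. real N * (\<Sum>y | y < n \<and> \<kappa> y = (b, i). (w y)\<^sup>2)))"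
    using X \<gamma> by (intro sum_mono mult_left_mono) auto
  also have "\<dots> = ?\<gamma> * real N * (\<Sum>b<s. \<Sum>i<L. \<Sum>y | y < n \<and> \<kappa> y = (b, i). (w y)\<^sup>2)"
    by (simp only: sum_distrib_left mult.assoc)
  also have "(\<Sum>b<s. \<Sum>i<L. \<Sum>y | y < n \<and> \<kappa> y = (b, i). (w y)\<^sup>2) =
      (\<Sum>b<s. \<Sum>i<L. \<Sum>y | y < n \<and> \<kappa> y = (b, i). if fst (\<kappa> y) < s then (w y)\<^sup>2 else 0)"
    by (intro sum.cong) auto
  also have "\<dots> = (\<Sum>y<n. if fst (\<kappa> y) < s then (w y)\<^sup>2 else 0)"
    using \<kappa> by (intro sum_by_label[symmetric]) auto
  also have "?\<gamma> * real N * \<dots> \<le> ?\<gamma> * real N * dotp n w w"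
    using \<gamma> unfolding dotp_def power2_eq_square by (intro mult_left_mono sum_mono) auto
  finally have "\<mu> * real N * (\<Sum>b<s. \<Sum>i<L. (col_sum w b i + (if Suc i < L then col_sum w b (Suc i) else - 1 * col_sum w b 0))\<^sup>2)
      \<le> \<mu> * real N * (?\<gamma> * real N * dotp n w w)"
    using \<mu> by (intro mult_left_mono) auto
  then show ?thesis
    unfolding stretch_entry by (simp only: power2_eq_square mult_ac)
qed

text \<open>The top right singular vector of a balanced block: constant on its \<open>L * N\<close>
  columns up to the signs \<open>c\<close>, which cancel those of the matrix.\<close>

definition block_vec :: "nat \<Rightarrow> nat \<Rightarrow> real" where
  "block_vec b y = (if fst (\<kappa> y) = b then c y / sqrt (real L * real N) else 0)"

lemma orthonormal_block_vec: "orthonormal n s block_vec"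
  unfolding orthonormal_def
proof (intro allI impI)
  fix b b' assume b: "b < s" "b' < s"
  have "dotp n (block_vec b) (block_vec b') =
      (\<Sum>y<n. if fst (\<kappa> y) = b \<and> b = b' then 1 / (real L * real N) else 0)"
    unfolding dotp_def using c by (intro sum.cong) (auto simp: block_vec_def power2_eq_square)
  also have "\<dots> = real N * (\<Sum>d<s. \<Sum>i<L. if fst (d, i) = b \<and> b = b' then 1 / (real L * real N) else 0)"
    using b by (intro sum_col_labels) auto
  also have "(\<Sum>d<s. \<Sum>i<L. if fst (d, i) = b \<and> b = b' then 1 / (real L * real N) else 0) =
      (\<Sum>d<s. if d = b then (if b = b' then real L * (1 / (real L * real N)) else 0) else 0)"
    by (intro sum.cong) auto
  finally show "dotp n (block_vec b) (block_vec b') = (if b = b' then 1 else 0)"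
    using b L N by simp
qed

lemma stretch_block_vec:
  assumes b: "b < s"
  shows "dotp n (mat_app n (entry 1) (block_vec b)) (mat_app n (entry 1) (block_vec b)) = 4 * \<mu> * (real N)\<^sup>2"
proof -
  let ?q = "real N / sqrt (real L * real N)"
  have X: "col_sum (block_vec b) d j = (if d = b then ?q else 0)" if "d < s" "j < L" for d j
  proof -
    have "col_sum (block_vec b) d j =
        (\<Sum>y | y < n \<and> \<kappa> y = (d, j). if d = b then 1 / sqrt (real L * real N) else 0)"
      unfolding col_sum_def using c by (intro sum.cong) (auto simp: block_vec_def power2_eq_square)
    then show ?thesis using that by (simp add: card_\<kappa>)
  qed
  have "(\<Sum>d<s. \<Sum>i<L. (col_sum (block_vec b) d i +
      (if Suc i < L then col_sum (block_vec b) d (Suc i) else 1 * col_sum (block_vec b) d 0))\<^sup>2)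
    = (\<Sum>d<s. \<Sum>i<L. if d = b then (2 * ?q)\<^sup>2 else 0)"
    using L by (intro sum.cong) (auto simp: X)
  also have "\<dots> = (\<Sum>d<s. if d = b then real L * (2 * ?q)\<^sup>2 else 0)"
    by (intro sum.cong) auto
  also have "\<dots> = 4 * real N"
    using b L N by (simp add: power_mult_distrib power_divide power2_eq_square)
  finally show ?thesis
    unfolding stretch_entry by (simp add: power2_eq_square)
qed

text \<open>In units of \<open>\<mu> * N^2\<close> a block has squared Frobenius norm
  \<open>2 * L\<close>, of which its block vector captures 4.\<close>

lemma lowrank_error_balanced:
  assumes "1 \<le> s" "s \<le> n"
  shows "lowrank_error s (Matrix.mat n n (\<lambda>(x, y). entry 1 x y)) \<le> \<mu> * (real N)\<^sup>2 * real s * (2 * real L - 4)"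
proof -
  let ?A = "Matrix.mat n n (\<lambda>(x, y). entry 1 x y)"
  have app: "mat_app n (\<lambda>x y. ?A $$ (x, y)) w x = mat_app n (entry 1) w x" if "x < n" for w x
    using that by (simp add: mat_app_def)
  have "dotp n (mat_app n (\<lambda>x y. ?A $$ (x, y)) w) (mat_app n (\<lambda>x y. ?A $$ (x, y)) w) =
      dotp n (mat_app n (entry 1) w) (mat_app n (entry 1) w)" for w
    by (intro dotp_cong app)
  then have "lowrank_error s ?A \<le> (\<Sum>x<n. \<Sum>y<n. (?A $$ (x, y))\<^sup>2) - (\<Sum>b<s. 4 * \<mu> * (real N)\<^sup>2)"
    using lowrank_error_le[of ?A n s block_vec, OF _ orthonormal_block_vec assms]
    by (simp add: stretch_block_vec)
  also have "(\<Sum>x<n. \<Sum>y<n. (?A $$ (x, y))\<^sup>2) = (\<Sum>x<n. \<Sum>y<n. (entry 1 x y)\<^sup>2)"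
    by (intro sum.cong) auto
  also have "\<dots> = \<mu> * (real N)\<^sup>2 * real s * (2 * real L)"
    by (rule frobenius_entry) simp
  finally show ?thesis by (simp add: algebra_simps)
qed

lemma lowrank_error_frustrated:
  "lowrank_error s (Matrix.mat n n (\<lambda>(x, y). entry (- 1) x y))
    \<ge> \<mu> * (real N)\<^sup>2 * real s * (2 * real L - 4 + 4 / (real L)\<^sup>2)"
proof -
  let ?A = "Matrix.mat n n (\<lambda>(x, y). entry (- 1) x y)"
  let ?\<gamma> = "4 - 4 / (real L)\<^sup>2"
  have app: "mat_app n (\<lambda>x y. ?A $$ (x, y)) w x = mat_app n (entry (- 1)) w x" if "x < n" for w x
    using that by (simp add: mat_app_def)
  have "dotp n (mat_app n (\<lambda>x y. ?A $$ (x, y)) w) (mat_app n (\<lambda>x y. ?A $$ (x, y)) w) =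
      dotp n (mat_app n (entry (- 1)) w) (mat_app n (entry (- 1)) w)" for w
    by (intro dotp_cong app)
  then have op: "dotp n (mat_app n (\<lambda>x y. ?A $$ (x, y)) w) (mat_app n (\<lambda>x y. ?A $$ (x, y)) w)
      \<le> (\<mu> * (real N)\<^sup>2 * ?\<gamma>) * dotp n w w" for w
    using stretch_frustrated[of w] by simp
  have "\<mu> \<ge> 0" using r[of 0] zero_le_power2[of "r 0"] by simp
  moreover have "1 \<le> (real L)\<^sup>2" using L by (intro one_le_power) simp
  then have "?\<gamma> \<ge> 0" using L by (simp add: divide_simps)
  ultimately have "\<mu> * (real N)\<^sup>2 * ?\<gamma> \<ge> 0" by (intro mult_nonneg_nonneg) auto
  then have "lowrank_error s ?A \<ge> (\<Sum>x<n. \<Sum>y<n. (?A $$ (x, y))\<^sup>2) - real s * (\<mu> * (real N)\<^sup>2 * ?\<gamma>)"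
    by (intro lowrank_error_ge op) auto
  moreover have "(\<Sum>x<n. \<Sum>y<n. (?A $$ (x, y))\<^sup>2) = (\<Sum>x<n. \<Sum>y<n. (entry (- 1) x y)\<^sup>2)"
    by (intro sum.cong) auto
  moreover have "\<dots> = \<mu> * (real N)\<^sup>2 * real s * (2 * real L)"
    by (rule frobenius_entry) simp
  ultimately show ?thesis by (simp add: algebra_simps)
qed

end

section \<open>Random permutations and hidden cycles\<close>

text \<open>Double counting by swaps. If \<open>p\<close> meets \<open>k + 1\<close> constraints and
  \<open>z\<close> avoids the first \<open>k\<close> points, exchanging the values at
  \<open>x k\<close> and \<open>z\<close> keeps the first \<open>k\<close> constraints, and with the
  old value \<open>p (x k)\<close> recorded nothing is lost. Each further constraint thus costs a
  factor \<open>N / (n - k)\<close>.\<close>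

lemma card_constrained_permutations_step:
  fixes n :: nat and x :: "nat \<Rightarrow> nat" and S :: "nat \<Rightarrow> nat set"
  defines "G \<equiv> \<lambda>k. {p. p permutes {..<n} \<and> (\<forall>i<k. p (x i) \<in> S i)}"
  assumes x: "\<And>i. i \<le> k \<Longrightarrow> x i < n" and disj: "\<And>i j. i < j \<Longrightarrow> j \<le> k \<Longrightarrow> S i \<inter> S j = {}"
    and S: "finite (S k)" "card (S k) \<le> N"
  shows "card (G (Suc k)) * (n - k) \<le> card (G k) * N"
proof (cases "G (Suc k) = {}")
  case False
  then obtain p0 where p0: "p0 permutes {..<n}" "\<And>i. i \<le> k \<Longrightarrow> p0 (x i) \<in> S i"
    by (auto simp: G_def less_Suc_eq_le)
  \<comment> \<open>Disjoint targets force \<open>x k\<close> to differ from the earlier points,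
    whose values the swap must not disturb.\<close>
  have dist: "x i \<noteq> x k" if "i < k" for i
    using p0(2)[of i] p0(2)[of k] disj[OF that] that by force
  have fin: "finite (G j)" for j
    by (rule finite_subset[OF _ finite_permutations[of "{..<n}"]]) (auto simp: G_def)
  define T where "T = {..<n} - x ` {..<k}"
  have "card (x ` {..<k}) \<le> k" using card_image_le[of "{..<k}" x] by simp
  then have T: "n - k \<le> card T"
    unfolding T_def using diff_card_le_card_Diff[of "x ` {..<k}" "{..<n}"] by simp
  define f where "f = (\<lambda>(p, z). (p \<circ> Transposition.transpose (x k) z, (p :: nat \<Rightarrow> nat) (x k)))"
  have "inj_on f (G (Suc k) \<times> T)"
  proof (rule inj_onI, clarify)
    fix p z p' z' assume p: "p \<in> G (Suc k)" "p' \<in> G (Suc k)" and eq: "f (p, z) = f (p', z')"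
    let ?r = "p \<circ> Transposition.transpose (x k) z" and ?r' = "p' \<circ> Transposition.transpose (x k) z'"
    have r: "?r = ?r'" and y: "p (x k) = p' (x k)" using eq by (auto simp: f_def)
    have "inj p" using p by (auto simp: G_def permutes_inj)
    then have "inj ?r" by (intro inj_compose) auto
    \<comment> \<open>\<open>z\<close> is recovered as the point that the swapped permutation sends
      to the recorded value.\<close>
    moreover have "?r z = ?r z'"
      using fun_cong[OF r, of z'] y by simp
    ultimately have "z = z'" by (rule injD)
    moreover have "?r \<circ> Transposition.transpose (x k) z = ?r' \<circ> Transposition.transpose (x k) z'"
      using r \<open>z = z'\<close> by simp
    then have "p = p'" by (simp add: comp_assoc)
    ultimately show "p = p' \<and> z = z'" by simp
  qed
  moreover have "f ` (G (Suc k) \<times> T) \<subseteq> G k \<times> S k"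
  proof clarify
    fix p z p' y assume pz: "p \<in> G (Suc k)" "z \<in> T" and eq: "(p', y) = f (p, z)"
    have "p' permutes {..<n}"
      using pz eq x by (auto simp: G_def f_def T_def intro!: permutes_compose permutes_swap_id)
    moreover have "p' (x i) \<in> S i" if "i < k" for i
    proof -
      have "x i \<noteq> z" using pz(2) that by (auto simp: T_def)
      then show ?thesis using dist[OF that] pz(1) that eq by (simp add: f_def G_def)
    qed
    ultimately show "p' \<in> G k \<and> y \<in> S k"
      using pz eq by (auto simp: G_def f_def)
  qed
  ultimately have "card (G (Suc k) \<times> T) \<le> card (G k \<times> S k)"
    by (rule card_inj_on_le) (use fin S in auto)
  then have "card (G (Suc k)) * card T \<le> card (G k) * card (S k)"
    by (simp add: card_cartesian_product)
  then show ?thesis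
    using T S(2) by (meson le_trans mult_le_mono2)
qed simp

lemma card_constrained_permutations:
  fixes x :: "nat \<Rightarrow> nat" and S :: "nat \<Rightarrow> nat set"
  assumes "\<And>i. i < k \<Longrightarrow> x i < n" "\<And>i j. i < j \<Longrightarrow> j < k \<Longrightarrow> S i \<inter> S j = {}"
    and "\<And>i. i < k \<Longrightarrow> finite (S i)" "\<And>i. i < k \<Longrightarrow> card (S i) \<le> N" and "2 * k \<le> n"
  shows "card {p. p permutes {..<n} \<and> (\<forall>i<k. p (x i) \<in> S i)} * n ^ k \<le> (2 * N) ^ k * fact n"
  using assms
proof (induction k)
  case 0
  then show ?case by (simp add: card_permutations)
next
  case (Suc k)
  let ?G = "\<lambda>k. {p. p permutes {..<n} \<and> (\<forall>i<k. p (x i) \<in> S i)}"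
  \<comment> \<open>At least half of the points are still free, so \<open>n - k\<close> may be
    replaced by \<open>n\<close> at the cost of a factor 2.\<close>
  have "card (?G (Suc k)) * n \<le> card (?G (Suc k)) * (2 * (n - k))"
    using Suc.prems(5) by (intro mult_le_mono2) auto
  also have "\<dots> \<le> 2 * (card (?G k) * N)"
    using card_constrained_permutations_step[of k x n S N] Suc.prems by (simp add: less_Suc_eq_le)
  finally have "card (?G (Suc k)) * n * n ^ k \<le> 2 * (card (?G k) * N) * n ^ k"
    by (rule mult_le_mono1)
  also have "\<dots> = (card (?G k) * n ^ k) * (2 * N)" by simp
  also have "\<dots> \<le> (2 * N) ^ k * fact n * (2 * N)"
    using Suc by (intro mult_le_mono1 Suc.IH) auto
  finally show ?case by (simp add: mult_ac)
qed

text \<open>Runs of \<open>N\<close> indices share a label and \<open>L\<close> runs form a block.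
  Indices from \<open>s * L * N\<close> on land in blocks numbered \<open>s\<close> or more, which
  disposes of the remainder of \<open>n\<close>.\<close>

definition label :: "nat \<Rightarrow> nat \<Rightarrow> nat \<Rightarrow> nat \<times> nat" where
  "label L N y = (y div N div L, y div N mod L)"

lemma card_label:
  assumes "0 < N" "s * L * N \<le> n" "b < s" "i < L"
  shows "card {y. y < n \<and> label L N y = (b, i)} = N"
proof -
  let ?I = "{(b * L + i) * N ..< (b * L + i) * N + N}"
  have l1: "label L N y = (b, i) \<longleftrightarrow> y div N = b * L + i" for y
    using assms(4) div_mult_mod_eq[of "y div N" L] by (auto simp: label_def)
  have l2: "y div N = b * L + i \<longleftrightarrow> y \<in> ?I" for y
  proof -
    have "y div N = b * L + i \<longleftrightarrow> b * L + i \<le> y div N \<and> y div N < Suc (b * L + i)" by auto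
    also have "\<dots> \<longleftrightarrow> (b * L + i) * N \<le> y \<and> y < Suc (b * L + i) * N"
      by (simp only: less_eq_div_iff_mult_less_eq[OF assms(1)] div_less_iff_less_mult[OF assms(1)])
    finally show ?thesis by (simp add: add.commute)
  qed
  have l3: "(b * L + i) * N + N \<le> n"
  proof -
    have "b * L + i + 1 \<le> b * L + L" using assms by simp
    also have "\<dots> \<le> s * L" using mult_le_mono1[of "Suc b" s L] assms by simp
    finally have "(b * L + i + 1) * N \<le> s * L * N" by (rule mult_le_mono1)
    then show ?thesis using assms(2) by (simp add: algebra_simps)
  qed
  have "y < n \<and> label L N y = (b, i) \<longleftrightarrow> y \<in> ?I" for y
    unfolding l1 l2 using l3 by (meson atLeastLessThan_iff less_le_trans)
  then have "{y. y < n \<and> label L N y = (b, i)} = ?I" by blast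
  then show ?thesis by simp
qed

text \<open>Only the pairs labelled \<open>((b, k), (b, k))\<close> matter: missing the pairs of a single \<open>k\<close> already
  breaks the cycle of block \<open>b\<close> open.\<close>

definition cycle_seen :: "nat \<Rightarrow> nat \<Rightarrow> nat \<Rightarrow> (nat \<times> nat) set \<Rightarrow> (nat \<Rightarrow> nat) \<Rightarrow> (nat \<Rightarrow> nat) \<Rightarrow> bool" where
  "cycle_seen s L N Q p t \<longleftrightarrow>
     (\<exists>b<s. \<forall>k<L. \<exists>(x, y)\<in>Q. label L N (p x) = (b, k) \<and> label L N (t y) = (b, k))"

text \<open>A union bound over the block and over one query per matching edge, at most
  \<open>s * q ^ L\<close> choices. Each choice constrains \<open>p\<close> and \<open>t\<close>
  separately, and distinct edges have disjoint label classes as targets. Powers of \<open>n\<close>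
  are multiplied out to stay in the natural numbers.\<close>

lemma card_cycle_seen_power:
  assumes Q: "Q \<subseteq> {..<n} \<times> {..<n}" "card Q \<le> q" and N: "0 < N" "s * L * N \<le> n" "2 * L \<le> n"
  shows "card {(p, t). p permutes {..<n} \<and> t permutes {..<n} \<and> cycle_seen s L N Q p t} * n ^ L * n ^ L
    \<le> s * q ^ L * ((2 * N) ^ L * fact n) * ((2 * N) ^ L * fact n)"
proof -
  let ?E = "PiE {..<L} (\<lambda>_. Q)"
  define S where "S b i = {y. y < n \<and> label L N y = (b, i)}" for b i
  define R where "R b e = {p. p permutes {..<n} \<and> (\<forall>i<L. p (fst (e i)) \<in> S b i)}"
    for b :: nat and e :: "nat \<Rightarrow> nat \<times> nat"
  define C where "C b e = {p. p permutes {..<n} \<and> (\<forall>i<L. p (snd (e i)) \<in> S b i)}"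
    for b :: nat and e :: "nat \<Rightarrow> nat \<times> nat"
  let ?Bad = "{(p, t). p permutes {..<n} \<and> t permutes {..<n} \<and> cycle_seen s L N Q p t}"
  have finQ: "finite Q" using Q(1) by (rule finite_subset) auto
  then have finE: "finite ?E" by (intro finite_PiE) auto
  have cardE: "card ?E \<le> q ^ L"
    using Q(2) by (simp add: card_PiE power_mono)
  have "?Bad \<subseteq> (\<Union>(b, e)\<in>{..<s} \<times> ?E. R b e \<times> C b e)"
  proof clarify
    fix p t assume p: "p permutes {..<n}" and t: "t permutes {..<n}" and "cycle_seen s L N Q p t"
    then obtain b where b: "b < s"
      and "\<forall>k<L. \<exists>e\<in>Q. label L N (p (fst e)) = (b, k) \<and> label L N (t (snd e)) = (b, k)"
      by (auto simp: cycle_seen_def split_beta)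
    then obtain e where e: "\<And>k. k < L \<Longrightarrow> e k \<in> Q"
      "\<And>k. k < L \<Longrightarrow> label L N (p (fst (e k))) = (b, k) \<and> label L N (t (snd (e k))) = (b, k)"
      by metis
    have mem: "fst (e k) < n" "snd (e k) < n" if "k < L" for k
      using e(1)[OF that] Q(1) by auto
    have "p z < n" "t z < n" if "z < n" for z
      using permutes_in_image[OF p, of z] permutes_in_image[OF t, of z] that by auto
    then have "p \<in> R b (restrict e {..<L})" "t \<in> C b (restrict e {..<L})"
      using p t e(2) mem by (auto simp: R_def C_def S_def)
    moreover have "restrict e {..<L} \<in> ?E" using e(1) by auto
    ultimately show "(p, t) \<in> (\<Union>(b, e)\<in>{..<s} \<times> ?E. R b e \<times> C b e)"
      using b by blast
  qed
  moreover have fin: "finite (R b e)" "finite (C b e)" for b e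
    by (rule finite_subset[OF _ finite_permutations[of "{..<n}"]]; force simp: R_def C_def)+
  ultimately have "card ?Bad \<le> card (\<Union>(b, e)\<in>{..<s} \<times> ?E. R b e \<times> C b e)"
    using finE by (intro card_mono) auto
  also have "\<dots> \<le> (\<Sum>(b, e)\<in>{..<s} \<times> ?E. card (R b e \<times> C b e))"
    using card_UN_le[of "{..<s} \<times> ?E" "\<lambda>(b, e). R b e \<times> C b e"] finE by (simp add: split_beta)
  finally have "card ?Bad * n ^ L * n ^ L \<le> (\<Sum>(b, e)\<in>{..<s} \<times> ?E. card (R b e \<times> C b e)) * n ^ L * n ^ L"
    by (intro mult_le_mono1)
  also have "\<dots> = (\<Sum>(b, e)\<in>{..<s} \<times> ?E. (card (R b e) * n ^ L) * (card (C b e) * n ^ L))"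
    by (simp add: sum_distrib_right sum_distrib_left split_beta card_cartesian_product mult_ac)
  also have "\<dots> \<le> (\<Sum>(b, e)\<in>{..<s} \<times> ?E. ((2 * N) ^ L * fact n) * ((2 * N) ^ L * fact n))"
  proof (rule sum_mono)
    fix z assume "z \<in> {..<s} \<times> ?E"
    then obtain b e where z: "z = (b, e)" and b: "b < s" and e: "e \<in> ?E" by blast
    have mem: "fst (e k) < n" "snd (e k) < n" if "k < L" for k
      using PiE_mem[OF e, of k] that Q(1) by auto
    have disj: "S b i \<inter> S b j = {}" if "i < j" "j < L" for i j
      using that by (auto simp: S_def)
    have S: "finite (S b i)" "card (S b i) \<le> N" if "i < L" for i
      using card_label[OF N(1,2) b that] by (auto simp: S_def)
    have "card (R b e) * n ^ L \<le> (2 * N) ^ L * fact n"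
      unfolding R_def using mem disj S N(3) by (intro card_constrained_permutations) auto
    moreover have "card (C b e) * n ^ L \<le> (2 * N) ^ L * fact n"
      unfolding C_def using mem disj S N(3) by (intro card_constrained_permutations) auto
    ultimately show "(case z of (b, e) \<Rightarrow> (card (R b e) * n ^ L) * (card (C b e) * n ^ L))
        \<le> (case z of (b, e) \<Rightarrow> ((2 * N) ^ L * fact n) * ((2 * N) ^ L * fact n))"
      unfolding z prod.case by (rule mult_le_mono)
  qed
  also have "\<dots> = s * card ?E * (((2 * N) ^ L * fact n) * ((2 * N) ^ L * fact n))"
    by (simp add: card_cartesian_product)
  also have "\<dots> \<le> s * q ^ L * (((2 * N) ^ L * fact n) * ((2 * N) ^ L * fact n))"
    using cardE by (intro mult_le_mono1 mult_le_mono2)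
  finally show ?thesis by (simp only: mult.assoc)
qed

text \<open>The factors 16 and \<open>s\<close> are at most \<open>2 ^ L\<close> each. What remains
  is the \<open>L\<close>-th power of \<open>4 * q * (2 * N)^2\<close>, at most
  \<open>(4 * s * N)^2\<close> and hence at most \<open>n^2\<close> by
  \<open>4 \<le> L\<close>.\<close>

lemma card_cycle_seen:
  assumes Q: "Q \<subseteq> {..<n} \<times> {..<n}" "card Q \<le> q" and N: "0 < N" "s * L * N \<le> n" "2 * L \<le> n"
    and q: "q < s\<^sup>2" and L: "4 \<le> L" "s \<le> 2 ^ L"
  shows "16 * card {(p, t). p permutes {..<n} \<and> t permutes {..<n} \<and> cycle_seen s L N Q p t}
    \<le> fact n * fact n" (is "16 * ?B \<le> _")
proof -
  have "0 < n" using N(3) L(1) by simp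
  have "16 * s * q ^ L * (2 * N) ^ L * (2 * N) ^ L \<le> n ^ L * n ^ L"
  proof -
    have "16 * s * q ^ L * (2 * N) ^ L * (2 * N) ^ L \<le> 2 ^ L * 2 ^ L * (s\<^sup>2) ^ L * (2 * N) ^ L * (2 * N) ^ L"
    proof (intro mult_le_mono1 mult_le_mono)
      show "16 \<le> (2::nat) ^ L" using power_increasing[OF L(1), of "2::nat"] by simp
      show "q ^ L \<le> (s\<^sup>2) ^ L" using q by (intro power_mono) simp_all
    qed (rule L(2))
    also have "\<dots> = (4 * s * N) ^ L * (4 * s * N) ^ L"
    proof -
      have "2 * 2 * s\<^sup>2 * (2 * N) * (2 * N) = (4 * s * N) * (4 * s * N)"
        by (simp add: power2_eq_square)
      then show ?thesis by (simp only: power_mult_distrib[symmetric])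
    qed
    also have "\<dots> \<le> n ^ L * n ^ L"
    proof -
      have "4 * s * N \<le> s * L * N" using L(1) by simp
      then have "4 * s * N \<le> n" using N(2) by linarith
      then show ?thesis by (intro mult_le_mono power_mono) auto
    qed
    finally show ?thesis .
  qed
  then have *: "16 * s * q ^ L * (2 * N) ^ L * (2 * N) ^ L * (fact n * fact n) \<le> n ^ L * n ^ L * (fact n * fact n)"
    by (rule mult_le_mono1)
  have "16 * ?B * (n ^ L * n ^ L) \<le> 16 * (s * q ^ L * ((2 * N) ^ L * fact n) * ((2 * N) ^ L * fact n))"
    using card_cycle_seen_power[OF Q N] by simp
  also have "\<dots> \<le> (fact n * fact n) * (n ^ L * n ^ L)"
    using * by (simp add: mult_ac)
  finally show ?thesis using \<open>0 < n\<close> by (subst (asm) mult_le_cancel2) simp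
qed

section \<open>The hard matrices and their gauge symmetry\<close>

definition flip :: "nat set \<Rightarrow> nat \<Rightarrow> real" where
  "flip F x = (if x \<in> F then - 1 else 1)"

text \<open>Signs are attached to positions after the permutation, so a gauge change is a symmetric
  difference with sets described by labels.\<close>

definition hard_mat :: "nat \<Rightarrow> nat \<Rightarrow> nat \<Rightarrow> nat \<Rightarrow> real \<Rightarrow> real \<Rightarrow> (nat \<Rightarrow> nat) \<times> (nat \<Rightarrow> nat) \<Rightarrow>
    nat set \<times> nat set \<Rightarrow> real mat" where
  "hard_mat n s L N \<alpha> e \<pi> \<Phi> = Matrix.mat n n (\<lambda>(x, y).
     \<alpha> * flip (fst \<Phi>) (fst \<pi> x) * flip (snd \<Phi>) (snd \<pi> y) *
     cycle_blocks s L e (label L N (fst \<pi> x)) (label L N (snd \<pi> y)))"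

lemma flip_symdiff: "flip (F - H \<union> (H - F)) x = flip F x * flip H x"
  by (auto simp: flip_def)

text \<open>Toggling by a fixed set is an involution, so uniform signs stay uniform under a gauge
  change.\<close>

lemma bij_betw_symdiff:
  assumes "H \<subseteq> X"
  shows "bij_betw (\<lambda>F. F - H \<union> (H - F)) (Pow X) (Pow X)"
  by (rule bij_betw_byWitness[where f' = "\<lambda>F. F - H \<union> (H - F)"]) (use assms in auto)

text \<open>The gauge transformation: flipping the rows \<open>i \<ge> k\<close> and the columns \<open>j > k\<close> of a block moves
  the frustration of its cycle to the pair \<open>(k, k)\<close>, where it is not seen.\<close>

lemma hard_mat_gauge:
  assumes p: "p permutes {..<n}" and t: "t permutes {..<n}" and Q: "Q \<subseteq> {..<n} \<times> {..<n}" and L: "2 \<le> L"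
    and "\<not> cycle_seen s L N Q p t"
  shows "\<exists>h. bij_betw h (Pow {..<n} \<times> Pow {..<n}) (Pow {..<n} \<times> Pow {..<n}) \<and>
    (\<forall>\<Phi>. \<forall>ij\<in>Q. hard_mat n s L N \<alpha> 1 (p, t) (h \<Phi>) $$ ij = hard_mat n s L N \<alpha> (- 1) (p, t) \<Phi> $$ ij)"
proof -
  have "\<forall>b. \<exists>k. b < s \<longrightarrow> k < L \<and>
      (\<forall>x y. (x, y) \<in> Q \<longrightarrow> label L N (p x) = (b, k) \<longrightarrow> label L N (t y) \<noteq> (b, k))"
    using assms(5) unfolding cycle_seen_def by blast
  then obtain k where "\<forall>b. b < s \<longrightarrow> k b < L \<and>
      (\<forall>x y. (x, y) \<in> Q \<longrightarrow> label L N (p x) = (b, k b) \<longrightarrow> label L N (t y) \<noteq> (b, k b))"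
    by (rule choice[THEN exE])
  then have k: "\<And>b. b < s \<Longrightarrow> k b < L"
    "\<And>b x y. b < s \<Longrightarrow> (x, y) \<in> Q \<Longrightarrow> label L N (p x) = (b, k b) \<Longrightarrow> label L N (t y) \<noteq> (b, k b)"
    by blast+
  \<comment> \<open>An edge changes sign when just one end is flipped. For \<open>(i, i + 1)\<close>
    both conditions agree, the closing edge has only its row flipped, and on the diagonal they
    differ at \<open>k\<close> alone.\<close>
  define H where "H = {z. z < n \<and> k (fst (label L N z)) \<le> snd (label L N z)}"
  define H' where "H' = {z. z < n \<and> k (fst (label L N z)) < snd (label L N z)}"
  define h where "h = map_prod (\<lambda>F. F - H \<union> (H - F)) (\<lambda>G. G - H' \<union> (H' - G))"
  have "bij_betw h (Pow {..<n} \<times> Pow {..<n}) (Pow {..<n} \<times> Pow {..<n})"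
    unfolding h_def by (intro bij_betw_map_prod bij_betw_symdiff) (auto simp: H_def H'_def)
  moreover have "hard_mat n s L N \<alpha> 1 (p, t) (h \<Phi>) $$ ij = hard_mat n s L N \<alpha> (- 1) (p, t) \<Phi> $$ ij"
    if "ij \<in> Q" for ij \<Phi>
  proof -
    obtain x y where ij: "ij = (x, y)" by (cases ij)
    then have xy: "x < n" "y < n" "(x, y) \<in> Q" using that Q by auto
    then have lt: "p x < n" "t y < n"
      using permutes_in_image[OF p, of x] permutes_in_image[OF t, of y] by auto
    obtain b i where l: "label L N (p x) = (b, i)" by (cases "label L N (p x)")
    obtain b' j where l': "label L N (t y) = (b', j)" by (cases "label L N (t y)")
    have "i < L" "j < L" using l l' L by (auto simp: label_def)
    then have "flip H (p x) * flip H' (t y) * cycle_blocks s L 1 (b, i) (b', j) = cycle_blocks s L (- 1) (b, i) (b', j)"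
      using lt l l' k(1)[of b] k(2)[OF _ xy(3), of b] L
      by (auto simp: flip_def H_def H'_def cycle_blocks_def signed_cycle_def)
    then show ?thesis
      using xy by (cases \<Phi>) (simp add: ij hard_mat_def h_def flip_symdiff l l' mult_ac)
  qed
  ultimately show ?thesis by blast
qed

text \<open>Averaged over all instances, correctness demands acceptance rates 1/2 apart. For fixed
  \<open>Q\<close>, reindexing by \<open>h\<close> cancels every \<open>a\<close> outside
  \<open>A'\<close>, so the rates differ by at most 1/16. Both \<open>h\<close> and
  \<open>A'\<close> may depend on \<open>Q\<close> because its law is the same for every input,
  which is where non-adaptivity enters.\<close>

lemma indistinguishable:
  fixes M\<^sub>0 M\<^sub>1 :: "'a \<Rightarrow> 'b \<Rightarrow> real mat" and alg :: nonadaptive_alg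
  assumes fin: "finite A" "finite B" "A \<noteq> {}" "B \<noteq> {}"
    and couple: "\<And>Q. Q \<in> set_pmf (fst alg) \<Longrightarrow> \<exists>A'\<subseteq>A. 16 * card A' \<le> card A \<and>
      (\<forall>a\<in>A - A'. \<exists>h. bij_betw h B B \<and> (\<forall>b. \<forall>ij\<in>Q. M\<^sub>1 a (h b) $$ ij = M\<^sub>0 a b $$ ij))"
    and acc\<^sub>0: "\<And>a b. a \<in> A \<Longrightarrow> b \<in> B \<Longrightarrow> measure_pmf.prob (run_alg alg (M\<^sub>0 a b)) {True} \<ge> 3 / 4"
    and acc\<^sub>1: "\<And>a b. a \<in> A \<Longrightarrow> b \<in> B \<Longrightarrow> measure_pmf.prob (run_alg alg (M\<^sub>1 a b)) {False} \<ge> 3 / 4"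
  shows False
proof -
  \<comment> \<open>The chance of output True once \<open>Q\<close> is drawn; it depends on the
    matrix only through the answers on \<open>Q\<close>.\<close>
  define \<phi> where "\<phi> M Q = pmf (snd alg Q (restrict (\<lambda>ij. M $$ ij) Q)) True" for M Q
  define E where "E M = measure_pmf.expectation (fst alg) (\<phi> M)" for M
  have \<phi>: "0 \<le> \<phi> M Q" "\<phi> M Q \<le> 1" for M Q
    by (auto simp: \<phi>_def pmf_le_1)
  have int: "integrable (measure_pmf (fst alg)) (\<phi> M)" for M
    by (rule measure_pmf.integrable_const_bound[where B = 1]) (use \<phi> in auto)
  have run: "pmf (run_alg alg M) True = E M" for M
    by (simp add: run_alg_def pmf_bind E_def \<phi>_def[abs_def])
  have E0: "E (M\<^sub>0 a b) \<ge> 3 / 4" and E1: "E (M\<^sub>1 a b) \<le> 1 / 4" if "a \<in> A" "b \<in> B" for a b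
    using acc\<^sub>0[OF that] acc\<^sub>1[OF that]
    by (auto simp: measure_pmf_single run[symmetric] pmf_False_conv_True)
  define g where "g Q = (\<Sum>a\<in>A. \<Sum>b\<in>B. \<phi> (M\<^sub>0 a b) Q - \<phi> (M\<^sub>1 a b) Q)" for Q
  have g: "g Q \<le> real (card A) * real (card B) / 16" if Q: "Q \<in> set_pmf (fst alg)" for Q
  proof -
    obtain A' where A': "A' \<subseteq> A" "16 * card A' \<le> card A"
      "\<And>a. a \<in> A - A' \<Longrightarrow> \<exists>h. bij_betw h B B \<and> (\<forall>b. \<forall>ij\<in>Q. M\<^sub>1 a (h b) $$ ij = M\<^sub>0 a b $$ ij)"
      using couple[OF Q] by blast
    have "(\<Sum>b\<in>B. \<phi> (M\<^sub>0 a b) Q - \<phi> (M\<^sub>1 a b) Q) \<le> (if a \<in> A' then real (card B) else 0)" if a: "a \<in> A" for a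
    proof (cases "a \<in> A'")
      case True
      have "(\<Sum>b\<in>B. \<phi> (M\<^sub>0 a b) Q - \<phi> (M\<^sub>1 a b) Q) \<le> (\<Sum>b\<in>B. 1)"
        using \<phi> by (intro sum_mono) (smt (verit))
      then show ?thesis using True by simp
    next
      case False
      then obtain h where h: "bij_betw h B B" "\<forall>b. \<forall>ij\<in>Q. M\<^sub>1 a (h b) $$ ij = M\<^sub>0 a b $$ ij"
        using A'(3)[of a] a by blast
      have "(\<Sum>b\<in>B. \<phi> (M\<^sub>1 a b) Q) = (\<Sum>b\<in>B. \<phi> (M\<^sub>1 a (h b)) Q)"
        using sum.reindex_bij_betw[OF h(1), of "\<lambda>b. \<phi> (M\<^sub>1 a b) Q"] by simp
      also have "\<dots> = (\<Sum>b\<in>B. \<phi> (M\<^sub>0 a b) Q)"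
      proof (rule sum.cong)
        fix b
        have "restrict (\<lambda>ij. M\<^sub>1 a (h b) $$ ij) Q = restrict (\<lambda>ij. M\<^sub>0 a b $$ ij) Q"
          using h(2) by (intro restrict_ext) auto
        then show "\<phi> (M\<^sub>1 a (h b)) Q = \<phi> (M\<^sub>0 a b) Q" by (simp add: \<phi>_def)
      qed simp
      finally show ?thesis using False by (simp add: sum_subtractf)
    qed
    then have "g Q \<le> (\<Sum>a\<in>A. if a \<in> A' then real (card B) else 0)"
      unfolding g_def by (intro sum_mono)
    also have "\<dots> = real (card A') * real (card B)"
      using A'(1) fin(1) by (simp add: sum.If_cases Int_absorb1)
    also have "\<dots> \<le> real (card A) / 16 * real (card B)"
      using A'(2) by (intro mult_right_mono) auto
    finally show ?thesis by simp
  qed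
  have "real (card A) * real (card B) / 2 = (\<Sum>a\<in>A. \<Sum>b\<in>B. 3 / 4 - 1 / 4)"
    by simp
  also have "\<dots> \<le> (\<Sum>a\<in>A. \<Sum>b\<in>B. E (M\<^sub>0 a b) - E (M\<^sub>1 a b))"
    using E0 E1 by (intro sum_mono diff_mono) auto
  also have "\<dots> = measure_pmf.expectation (fst alg) g"
    unfolding g_def E_def using int by (simp add: Bochner_Integration.integral_sum integrable_sum)
  also have "\<dots> \<le> real (card A) * real (card B) / 16"
    using int g by (intro measure_pmf.integral_le_const) (auto simp: g_def AE_measure_pmf_iff)
  finally have "real (card A) * real (card B) \<le> 0" by simp
  moreover have "real (card A) * real (card B) > 0"
    using fin by (simp add: card_gt_0_iff)
  ultimately show False by simp
qed

section \<open>The lower bound\<close>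

lemma lg_ge_1: "1 \<le> lg m"
  by (simp add: lg_def)

lemma lg_mono:
  assumes "1 \<le> m" "m \<le> m'"
  shows "lg m \<le> lg m'"
proof -
  have "log 2 (real m) \<le> log 2 (real m')" using assms by simp
  then show ?thesis unfolding lg_def by (rule max.mono[OF order_refl])
qed

text \<open>Rounding up gives \<open>s \<le> 2 ^ L\<close>. As \<open>lg\<close> is at least 1, the
  added 3 gives \<open>L \<ge> 4\<close>, and \<open>L\<close> stays within
  \<open>5 * lg s\<close>.\<close>

definition half_cycle_len :: "nat \<Rightarrow> nat" where
  "half_cycle_len s = nat \<lceil>lg s\<rceil> + 3"

lemma half_cycle_len:
  shows "4 \<le> half_cycle_len s" "real (half_cycle_len s) \<le> 5 * lg s"
    and "1 \<le> s \<Longrightarrow> s \<le> 2 ^ half_cycle_len s"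
proof -
  have 1: "1 \<le> \<lceil>lg s\<rceil>" using lg_ge_1[of s] by linarith
  then show "4 \<le> half_cycle_len s" unfolding half_cycle_len_def by linarith
  have L: "real (half_cycle_len s) = real_of_int \<lceil>lg s\<rceil> + 3"
    using 1 by (simp add: half_cycle_len_def)
  then show "real (half_cycle_len s) \<le> 5 * lg s"
    using lg_ge_1[of s] ceiling_correct[of "lg s"] by linarith
  assume s: "1 \<le> s"
  have "log 2 (real s) \<le> lg s" by (simp add: lg_def)
  also have "\<dots> \<le> real (half_cycle_len s)" using L ceiling_correct[of "lg s"] by linarith
  finally have "2 powr log 2 (real s) \<le> 2 powr real (half_cycle_len s)" by simp
  then have "real s \<le> 2 ^ half_cycle_len s" using s by (simp add: powr_realpow)
  then show "s \<le> 2 ^ half_cycle_len s" by (metis of_nat_le_iff of_nat_numeral of_nat_power)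
qed

lemma max_norm_le:
  assumes "0 < n" and "\<And>i j. i < n \<Longrightarrow> j < n \<Longrightarrow> \<bar>f (i, j)\<bar> \<le> b"
  shows "max_norm (Matrix.mat n n f) \<le> b"
proof -
  let ?E = "elements_mat (Matrix.mat n n f)"
  have "finite ?E" by (simp add: elements_mat_def)
  moreover have "f (0, 0) \<in> ?E" using assms(1) by (intro elements_matI[of _ n n 0 0]) auto
  then have "?E \<noteq> {}" by blast
  ultimately show ?thesis
    unfolding max_norm_def using assms(2) by (subst Max_le_iff) auto
qed

text \<open>Permutations preserve the sizes of label classes, so every sample is a
  \<open>cycle_blowup\<close> and obeys the bounds, not just a typical one.\<close>

lemma hard_mat_props:
  assumes p: "p permutes {..<n}" and t: "t permutes {..<n}"
    and sN: "1 \<le> s" "s \<le> n" "0 < N" "s * L * N \<le> n" "2 \<le> L" and \<mu>: "0 \<le> \<mu>" "\<mu> \<le> 1"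
  shows "e \<in> {1, - 1} \<Longrightarrow> max_norm (hard_mat n s L N (sqrt \<mu>) e (p, t) \<Phi>) \<le> 1"
    and "lowrank_error s (hard_mat n s L N (sqrt \<mu>) 1 (p, t) \<Phi>) \<le> \<mu> * (real N)\<^sup>2 * real s * (2 * real L - 4)"
    and "lowrank_error s (hard_mat n s L N (sqrt \<mu>) (- 1) (p, t) \<Phi>)
      \<ge> \<mu> * (real N)\<^sup>2 * real s * (2 * real L - 4 + 4 / (real L)\<^sup>2)"
proof -
  have card_perm: "card {x. x < n \<and> label L N (\<pi> x) = (b, i)} = N"
    if \<pi>: "\<pi> permutes {..<n}" and "b < s" "i < L" for \<pi> b i
  proof -
    have "\<pi> x < n \<longleftrightarrow> x < n" for x
      using permutes_in_image[OF \<pi>, of x] by simp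
    then have "{x. x < n \<and> label L N (\<pi> x) = (b, i)} = \<pi> -` {y. y < n \<and> label L N y = (b, i)}"
      by auto
    moreover have "card (\<pi> -` {y. y < n \<and> label L N y = (b, i)}) = card {y. y < n \<and> label L N y = (b, i)}"
      using permutes_inj[OF \<pi>] permutes_surj[OF \<pi>] by (intro card_vimage_inj) auto
    ultimately show ?thesis using card_label[OF sN(3,4) that(2,3)] by simp
  qed
  interpret cycle_blowup n s L N \<mu> "\<lambda>x. sqrt \<mu> * flip (fst \<Phi>) (p x)" "\<lambda>y. flip (snd \<Phi>) (t y)"
    "\<lambda>x. label L N (p x)" "\<lambda>y. label L N (t y)"
    by unfold_locales
      (use \<mu> sN card_perm[OF p] card_perm[OF t] in \<open>auto simp: flip_def label_def power_mult_distrib\<close>)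
  have hard: "hard_mat n s L N (sqrt \<mu>) e (p, t) \<Phi> = Matrix.mat n n (\<lambda>(x, y). entry e x y)" for e
    unfolding hard_mat_def entry_def by (intro cong_mat) auto
  show "lowrank_error s (hard_mat n s L N (sqrt \<mu>) 1 (p, t) \<Phi>) \<le> \<mu> * (real N)\<^sup>2 * real s * (2 * real L - 4)"
    unfolding hard by (rule lowrank_error_balanced[OF sN(1,2)])
  show "lowrank_error s (hard_mat n s L N (sqrt \<mu>) (- 1) (p, t) \<Phi>)
      \<ge> \<mu> * (real N)\<^sup>2 * real s * (2 * real L - 4 + 4 / (real L)\<^sup>2)"
    unfolding hard by (rule lowrank_error_frustrated)
  assume e: "e \<in> {1, - 1}"
  show "max_norm (hard_mat n s L N (sqrt \<mu>) e (p, t) \<Phi>) \<le> 1"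
    unfolding hard
  proof (rule max_norm_le)
    fix x y
    have "\<bar>cycle_blocks s L e l m\<bar> \<le> 1" for l m
      using e sN(5) by (auto simp: cycle_blocks_def signed_cycle_def)
    moreover have "\<bar>flip F z\<bar> = 1" for F z by (simp add: flip_def)
    ultimately show "\<bar>case (x, y) of (x, y) \<Rightarrow> entry e x y\<bar> \<le> 1"
      using \<mu> by (simp add: entry_def abs_mult mult_le_one)
  qed (use sN in simp)
qed

theorem mainTheorem7:
  shows "\<exists>(c::real) > 0. \<exists>(\<epsilon>\<^sub>0 :: nat \<Rightarrow> real) (lower_bd :: nat \<Rightarrow> real) (K::real) (k::nat).
     Theta_tilde \<epsilon>\<^sub>0 (\<lambda>s. 1) \<and>
     Omega_tilde lower_bd (\<lambda>s. (real s)\<^sup>2) \<and>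
     K > 0 \<and>
     (\<forall>(n::nat) (s::nat). 1 \<le> s \<and> real s \<le> real n / (K * lg n ^ k) \<longrightarrow>
        (\<forall>(alg::nonadaptive_alg) (q::nat).
           queries_at_most n q alg \<and>
           distinguishes n
             (\<lambda>A. lowrank_error s A > c / lg s * ((real n)\<^sup>2 / real s))
             (\<lambda>A. lowrank_error s A < (1 - \<epsilon>\<^sub>0 s) * (c / lg s) * ((real n)\<^sup>2 / real s))
             alg
           \<longrightarrow> real q \<ge> lower_bd s))"
proof (intro exI conjI allI impI)
  \<comment> \<open>The threshold will exceed the balanced error by \<open>2 / L^2\<close> on a
    scale where it is below \<open>2 * L\<close>, so a relative gap \<open>1 / L^3\<close> fits. The
    value of \<open>?c\<close> keeps the rescaled entries at most 1.\<close>
  let ?\<epsilon> = "\<lambda>s. 1 / (real (half_cycle_len s)) ^ 3" and ?c = "1 / 20 :: real"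
  \<comment> \<open>10 is twice the 5 of \<open>L \<le> 5 * lg s\<close>: it yields
    \<open>2 * (s * L) \<le> n\<close>, hence a positive cell size \<open>N\<close>.\<close>
  show "?c > 0" "(10::real) > 0" by simp_all
  show "Omega_tilde (\<lambda>s. (real s)\<^sup>2) (\<lambda>s. (real s)\<^sup>2)"
    unfolding Omega_tilde_def by (rule exI[of _ 1], simp, rule exI[of _ 0], simp)
  have "?\<epsilon> s \<ge> (1 / 125) * 1 / lg s ^ 3" for s
  proof -
    have "real (half_cycle_len s) ^ 3 \<le> (5 * lg s) ^ 3"
      using half_cycle_len(2) by (intro power_mono) auto
    also have "\<dots> = 125 * lg s ^ 3" by (simp add: power_mult_distrib)
    finally show ?thesis
      using half_cycle_len(1)[of s] lg_ge_1[of s] by (simp add: divide_simps)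
  qed
  then have "Omega_tilde ?\<epsilon> (\<lambda>s. 1)"
    unfolding Omega_tilde_def by (intro exI[of _ "1 / 125"] exI[of _ 3]) auto
  moreover have \<epsilon>_le: "?\<epsilon> s \<le> 1" for s
    using half_cycle_len(1)[of s] by (simp add: divide_simps one_le_power)
  have "O_tilde ?\<epsilon> (\<lambda>s. 1)"
    unfolding O_tilde_def by (rule exI[of _ 1], simp, rule exI[of _ 0], use \<epsilon>_le in simp)
  ultimately show "Theta_tilde ?\<epsilon> (\<lambda>s. 1)" by (simp add: Theta_tilde_def)

  fix n s q :: nat and alg :: nonadaptive_alg
  assume "1 \<le> s \<and> real s \<le> real n / (10 * lg n ^ 1)"
  then have s: "1 \<le> s" and sn: "real s * (10 * lg n) \<le> real n"
    using lg_ge_1[of n] by (auto simp: field_simps)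
  assume "queries_at_most n q alg \<and> distinguishes n
    (\<lambda>A. lowrank_error s A > ?c / lg s * ((real n)\<^sup>2 / real s))
    (\<lambda>A. lowrank_error s A < (1 - ?\<epsilon> s) * (?c / lg s) * ((real n)\<^sup>2 / real s)) alg"
  then have alg: "queries_at_most n q alg" and dist: "distinguishes n
    (\<lambda>A. lowrank_error s A > ?c / lg s * ((real n)\<^sup>2 / real s))
    (\<lambda>A. lowrank_error s A < (1 - ?\<epsilon> s) * (?c / lg s) * ((real n)\<^sup>2 / real s)) alg"
    by blast+
  show "(real s)\<^sup>2 \<le> real q"
  proof (rule ccontr)
    assume "\<not> (real s)\<^sup>2 \<le> real q"
    then have q: "q < s\<^sup>2" by (metis not_le of_nat_le_iff of_nat_power)
    define L where "L = half_cycle_len s"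
    define N where "N = n div (s * L)"
    define T where "T = ?c / lg s * ((real n)\<^sup>2 / real s)"
    \<comment> \<open>The midpoint of the factors of the balanced and the frustrated error; \<mu> is
      the scale at which \<open>D\<close> corresponds exactly to the threshold
      \<open>T\<close>.\<close>
    define D where "D = 2 * real L - 4 + 2 / (real L)\<^sup>2"
    define \<mu> where "\<mu> = T / ((real N)\<^sup>2 * real s * D)"
    have L: "4 \<le> L" "real L \<le> 5 * lg s" "s \<le> 2 ^ L"
      using half_cycle_len[of s] s by (simp_all add: L_def)
    have lgs: "1 \<le> lg s" by (rule lg_ge_1)
    have "real s * 10 \<le> real s * (10 * lg n)" using lg_ge_1[of n] s by simp
    then have "s \<le> n" using sn by linarith
    have "2 * (real s * real L) \<le> 2 * (real s * (5 * lg s))"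
      using L(2) by (intro mult_left_mono) auto
    also have "\<dots> \<le> real s * (10 * lg n)"
      using lg_mono[OF s \<open>s \<le> n\<close>] by (simp add: mult_left_mono)
    also have "\<dots> \<le> real n" by (rule sn)
    finally have n: "2 * (s * L) \<le> n"
      by (metis of_nat_le_iff of_nat_mult of_nat_numeral)
    have sL: "0 < s * L" using s L(1) by simp
    have "1 * L \<le> s * L" using s by (intro mult_le_mono1)
    then have n2: "2 * L \<le> n" using n by linarith
    have N: "0 < N" using n sL by (simp add: N_def div_greater_zero_iff)
    have sLN: "s * L * N \<le> n" by (simp add: N_def)
    \<comment> \<open>Rounding \<open>N\<close> down loses at most a factor 2. Its square and the 5
      of \<open>L \<le> 5 * lg s\<close> are absorbed by \<open>?c\<close>.\<close>
    have "n < s * L * Suc N" unfolding N_def using sL by (simp add: dividend_less_times_div)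
    also have "\<dots> \<le> s * L * (2 * N)" using N by (intro mult_le_mono2) auto
    finally have "n \<le> 2 * (s * L * N)" by simp
    then have "real n \<le> real (2 * (s * L * N))" by (rule of_nat_mono)
    then have "real n \<le> 2 * (real s * real L * real N)" by simp
    then have "(real n)\<^sup>2 \<le> (2 * (real s * real L * real N))\<^sup>2" by (intro power_mono) auto
    then have "T \<le> ?c / lg s * ((2 * (real s * real L * real N))\<^sup>2 / real s)"
      unfolding T_def using lgs s by (intro mult_left_mono divide_right_mono) auto
    also have "\<dots> = (real N)\<^sup>2 * real s * real L * (real L / (5 * lg s))"
      using s lgs by (simp add: power2_eq_square)
    also have "\<dots> \<le> (real N)\<^sup>2 * real s * real L * 1"
      using L(2) lgs by (intro mult_left_mono) auto
    also have "\<dots> \<le> (real N)\<^sup>2 * real s * D"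
    proof -
      have "4 \<le> real L" "0 \<le> 2 / (real L)\<^sup>2" using L(1) by simp_all
      then have "real L \<le> D" unfolding D_def by linarith
      then show ?thesis by (simp add: mult_left_mono)
    qed
    finally have T_le: "T \<le> (real N)\<^sup>2 * real s * D" .
    have D: "0 < D" using L(1) unfolding D_def by (intro add_pos_pos) auto
    have T: "0 < T" using lgs s \<open>s \<le> n\<close> by (simp add: T_def)
    have \<mu>: "0 \<le> \<mu>" "\<mu> \<le> 1" and \<mu>T: "\<mu> * (real N)\<^sup>2 * real s = T / D"
      using T T_le D N s by (auto simp: \<mu>_def divide_simps)
    have gap1: "T / D * (2 * real L - 4 + 4 / (real L)\<^sup>2) > T"
    proof -
      have "2 / (real L)\<^sup>2 < 4 / (real L)\<^sup>2" using L(1) by (simp add: divide_simps)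
      then have "D < 2 * real L - 4 + 4 / (real L)\<^sup>2" by (simp add: D_def)
      then have "T / D * D < T / D * (2 * real L - 4 + 4 / (real L)\<^sup>2)"
        using T D by (intro mult_strict_left_mono) auto
      then show ?thesis using D by simp
    qed
    \<comment> \<open>\<open>D < 2 * L\<close> makes \<open>D / L ^ 3\<close> smaller than the
      distance \<open>2 / L^2\<close> from \<open>D\<close> down to the balanced factor.\<close>
    have gap0: "T / D * (2 * real L - 4) < (1 - ?\<epsilon> s) * T"
    proof -
      have "D < 2 * real L"
      proof -
        have "2 / (real L)\<^sup>2 \<le> 2 / 1"
          using L(1) by (intro divide_left_mono one_le_power) auto
        then show ?thesis by (simp add: D_def)
      qed
      then have "D / real L ^ 3 < 2 * real L / real L ^ 3"
        using L(1) by (intro divide_strict_right_mono) auto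
      also have "\<dots> = 2 / (real L)\<^sup>2"
        using L(1) by (simp add: power3_eq_cube power2_eq_square)
      finally have "D / real L ^ 3 < 2 / (real L)\<^sup>2" .
      moreover have "(1 - 1 / real L ^ 3) * D = D - D / real L ^ 3" by (simp add: algebra_simps)
      moreover have "2 * real L - 4 = D - 2 / (real L)\<^sup>2" by (simp add: D_def)
      ultimately have "2 * real L - 4 < (1 - 1 / real L ^ 3) * D" by linarith
      then have "T / D * (2 * real L - 4) < T / D * ((1 - 1 / real L ^ 3) * D)"
        using T D by (intro mult_strict_left_mono) auto
      then show ?thesis using D by (simp add: L_def mult.commute)
    qed
    let ?P = "{p. p permutes {..<n}} \<times> {p. p permutes {..<n}}" and ?S = "Pow {..<n} \<times> Pow {..<n}"
    let ?M = "hard_mat n s L N (sqrt \<mu>)"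
    have carrier: "?M e \<pi> \<Phi> \<in> carrier_mat n n" for e \<pi> \<Phi> by (simp add: hard_mat_def)
    have L2: "2 \<le> L" using L(1) by simp
    note props = hard_mat_props[OF _ _ s \<open>s \<le> n\<close> N sLN L2 \<mu>]
    have frustrated: "measure_pmf.prob (run_alg alg (?M (- 1) \<pi> \<Phi>)) {True} \<ge> 3 / 4" if \<pi>P: "\<pi> \<in> ?P" for \<pi> \<Phi>
    proof -
      obtain p t where \<pi>: "\<pi> = (p, t)" "p permutes {..<n}" "t permutes {..<n}" using \<pi>P by blast
      have "lowrank_error s (?M (- 1) \<pi> \<Phi>) > ?c / lg s * ((real n)\<^sup>2 / real s)"
        using props(3)[OF \<pi>(2,3), of \<Phi>] gap1 unfolding \<mu>T \<pi>(1) T_def[symmetric] by linarith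
      moreover have "max_norm (?M (- 1) \<pi> \<Phi>) \<le> 1"
        unfolding \<pi>(1) by (rule props(1)[OF \<pi>(2,3)]) simp
      ultimately show ?thesis using dist carrier unfolding distinguishes_def by blast
    qed
    have balanced: "measure_pmf.prob (run_alg alg (?M 1 \<pi> \<Phi>)) {False} \<ge> 3 / 4" if \<pi>P: "\<pi> \<in> ?P" for \<pi> \<Phi>
    proof -
      obtain p t where \<pi>: "\<pi> = (p, t)" "p permutes {..<n}" "t permutes {..<n}" using \<pi>P by blast
      have "(1 - ?\<epsilon> s) * (?c / lg s) * ((real n)\<^sup>2 / real s) = (1 - ?\<epsilon> s) * T"
        by (simp only: T_def mult.assoc)
      then have "lowrank_error s (?M 1 \<pi> \<Phi>) < (1 - ?\<epsilon> s) * (?c / lg s) * ((real n)\<^sup>2 / real s)"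
        using props(2)[OF \<pi>(2,3), of \<Phi>] gap0 unfolding \<mu>T \<pi>(1) by linarith
      moreover have "max_norm (?M 1 \<pi> \<Phi>) \<le> 1"
        unfolding \<pi>(1) by (rule props(1)[OF \<pi>(2,3)]) simp
      ultimately show ?thesis using dist carrier unfolding distinguishes_def by blast
    qed
    show False
    \<comment> \<open>Frustrated instances call for True and act as \<open>M\<^sub>0\<close>; the
      balanced ones act as \<open>M\<^sub>1\<close>, which comes first in the instantiation.\<close>
    proof (rule indistinguishable[of ?P ?S alg "?M 1" "?M (- 1)"])
      fix Q assume "Q \<in> set_pmf (fst alg)"
      then have Q: "Q \<subseteq> {..<n} \<times> {..<n}" "card Q \<le> q"
        using alg by (auto simp: queries_at_most_def)
      let ?B = "{(p, t). p permutes {..<n} \<and> t permutes {..<n} \<and> cycle_seen s L N Q p t}"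
      have "card ?P = fact n * fact n"
        by (simp add: card_cartesian_product card_permutations)
      then have "16 * card ?B \<le> card ?P"
        using card_cycle_seen[OF Q N sLN n2 q L(1,3)] by simp
      moreover have "?B \<subseteq> ?P" by auto
      moreover have "\<exists>h. bij_betw h ?S ?S \<and> (\<forall>\<Phi>. \<forall>ij\<in>Q. ?M 1 \<pi> (h \<Phi>) $$ ij = ?M (- 1) \<pi> \<Phi> $$ ij)"
        if \<pi>P: "\<pi> \<in> ?P - ?B" for \<pi>
      proof -
        obtain p t where \<pi>: "\<pi> = (p, t)" "p permutes {..<n}" "t permutes {..<n}" "\<not> cycle_seen s L N Q p t"
          using \<pi>P by blast
        show ?thesis unfolding \<pi>(1) by (rule hard_mat_gauge[OF \<pi>(2,3) Q(1) L2 \<pi>(4)])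
      qed
      ultimately show "\<exists>A'\<subseteq>?P. 16 * card A' \<le> card ?P \<and> (\<forall>\<pi>\<in>?P - A'. \<exists>h. bij_betw h ?S ?S \<and>
          (\<forall>\<Phi>. \<forall>ij\<in>Q. ?M 1 \<pi> (h \<Phi>) $$ ij = ?M (- 1) \<pi> \<Phi> $$ ij))"
        by blast
    next
      have "id \<in> {p. p permutes {..<n}}" by (simp add: permutes_id)
      then show "?P \<noteq> {}" by blast
    qed (use frustrated balanced in \<open>auto simp: finite_permutations\<close>)
  qed
qed

end
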